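(* Let $r\ge 2$ and $d\ge 2$ be fixed integers. If $H$ denotes the average entropy of the SVS algorithm over $\mathcal{F}_{r,d}$, then $$H\ge\frac{1}{2\mu_d}\log(q^{r-1})\,\big(1+\mathcal{O}(q^{-1})\big).$$
   Context: $\mathbb{F}_q$ is the finite field with $q$ elements, and $\mathcal{F}_{r,d}$ is the set of all polynomials $F\in\mathbb{F}_q[X_1,\dots,X_r]$ of total degree at most $d$. Put $\mu_d:=\sum_{j=1}^d\frac{(-1)^{j-1}}{j!}$; $\log$ is the natural logarithm. The SVS ("Search on Vertical Strips") algorithm: on input $F\in\mathcal{F}_{r,d}$, it chooses successively elements $a_1,a_2,\dots$ of $\mathbb{F}_q^{r-1}$, where $a_i$ is chosen uniformly at random in $\mathbb{F}_q^{r-1}\setminus\{a_1,\dots,a_{i-1}\}$, until an $a_i$ is found such that $F(a_i,X_r)$ has a zero in $\mathbb{F}_q$ (or all of $\mathbb{F}_q^{r-1}$ is exhausted, in which case it returns "failure"). For the first such $a_i$, it outputs $(a_i,x)$, where $x\in\mathbb{F}_q$ is a zero of $F(a_i,X_r)$ computed by a randomized univariate root-finding routine for which all the zeros in $\mathbb{F}_q$ are equiprobable outputs (the random choices of this routine being independent of the choice of the $a_i$). For $F\in\mathcal{F}_{r,d}$ let $Z(F):=\{\mathbf{x}\in\mathbb{F}_q^r:F(\mathbf{x})=0\}$, let $P_{\mathbf{x},F}$ be the probability that the SVS algorithm outputs $\mathbf{x}$ on input $F$, and define $$H_F:=\sum_{\mathbf{x}\in Z(F)}-P_{\mathbf{x},F}\log(P_{\mathbf{x},F}),\qquad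 H:=\frac{1}{|\mathcal{F}_{r,d}|}\sum_{F\in\mathcal{F}_{r,d}}H_F .$$ Asymptotic estimates are for fixed $d$ and $r$ and $q\to\infty$; implied constants may depend on $d$ and $r$ but not on $q$. *)

theory Defs
  imports
    "HOL-Probability.Probability_Mass_Function"
    "HOL-Library.Landau_Symbols"
    "HOL-Algebra.Indexed_Polynomials"
begin

definition svs_mu :: "nat \<Rightarrow> real" where
  "svs_mu d = (\<Sum>j=1..d. (- 1) ^ (j - 1) / fact j)"

text \<open>
  Multivariate polynomials over \<open>R\<close> are those of \<open>HOL-Algebra\<close>: functions from monomials
  (multisets of indices of variables) to coefficients. The variables \<open>X\<^sub>1, \<dots>, X\<^sub>r\<close> have the indices
  \<open>0, \<dots>, r - 1\<close>, and the total degree of a monomial is the size of the multiset. The zero polynomial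
  belongs to every \<open>mpolys_deg_le R r d\<close>.
\<close>

definition mpolys_deg_le :: "('a, 'b) ring_scheme \<Rightarrow> nat \<Rightarrow> nat \<Rightarrow> (nat multiset \<Rightarrow> 'a) set" where
  "mpolys_deg_le R r d =
     {F \<in> ring.indexed_pset R {..<r} (carrier R). \<forall>m. F m \<noteq> \<zero>\<^bsub>R\<^esub> \<longrightarrow> size m \<le> d}"

text \<open>Points of affine \<open>n\<close>-space are lists of length \<open>n\<close>; thus \<open>a @ [x]\<close> is the point \<open>(a, x)\<close>.\<close>

definition affine_space :: "('a, 'b) ring_scheme \<Rightarrow> nat \<Rightarrow> 'a list set" where
  "affine_space R n = {xs. length xs = n \<and> set xs \<subseteq> carrier R}"

definition mpoly_eval :: "('a, 'b) ring_scheme \<Rightarrow> (nat multiset \<Rightarrow> 'a) \<Rightarrow> 'a list \<Rightarrow> 'a" where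
  "mpoly_eval R F xs =
     (\<Oplus>\<^bsub>R\<^esub>m\<in>{m. F m \<noteq> \<zero>\<^bsub>R\<^esub>}.
        F m \<otimes>\<^bsub>R\<^esub> finprod R (\<lambda>i. (xs ! i) [^]\<^bsub>R\<^esub> count m i) (set_mset m))"

definition zero_set :: "('a, 'b) ring_scheme \<Rightarrow> nat \<Rightarrow> (nat multiset \<Rightarrow> 'a) \<Rightarrow> 'a list set" where
  "zero_set R r F = {xs \<in> affine_space R r. mpoly_eval R F xs = \<zero>\<^bsub>R\<^esub>}"

text \<open>The zeros in \<open>R\<close> of the univariate polynomial \<open>F(a, X\<^sub>r)\<close>:\<close>

definition strip_zeros :: "('a, 'b) ring_scheme \<Rightarrow> (nat multiset \<Rightarrow> 'a) \<Rightarrow> 'a list \<Rightarrow> 'a set" where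
  "strip_zeros R F a = {x \<in> carrier R. mpoly_eval R F (a @ [x]) = \<zero>\<^bsub>R\<^esub>}"

text \<open>
  The search loop. The argument \<open>A\<close> is the set of elements that have not been chosen yet, and
  \<open>None\<close> stands for the answer ``failure''. (The finiteness test only serves to make the function
  total; \<open>A\<close> is always finite when \<open>R\<close> is.)
\<close>

function svs_search ::
  "('a, 'b) ring_scheme \<Rightarrow> (nat multiset \<Rightarrow> 'a) \<Rightarrow> 'a list set \<Rightarrow> 'a list option pmf" where
  "svs_search R F A =
     (if finite A \<and> A \<noteq> {} then
        bind_pmf (pmf_of_set A) (\<lambda>a.
          if strip_zeros R F a \<noteq> {}
          then map_pmf (\<lambda>x. Some (a @ [x])) (pmf_of_set (strip_zeros R F a))
          else svs_search R F (A - {a}))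
      else return_pmf None)"
  by pat_completeness auto
termination
  by (relation "Wellfounded.measure (\<lambda>(R, F, A). card A)") (auto simp: card_gt_0_iff)

declare svs_search.simps [simp del]

definition svs :: "('a, 'b) ring_scheme \<Rightarrow> nat \<Rightarrow> (nat multiset \<Rightarrow> 'a) \<Rightarrow> 'a list option pmf" where
  "svs R r F = svs_search R F (affine_space R (r - 1))"

text \<open>
  Since \<open>ln 0 = 0\<close>, the summand of a point of probability \<open>0\<close> vanishes.
\<close>

definition svs_entropy :: "('a, 'b) ring_scheme \<Rightarrow> nat \<Rightarrow> (nat multiset \<Rightarrow> 'a) \<Rightarrow> real" where
  "svs_entropy R r F =
     (\<Sum>x\<in>zero_set R r F. - pmf (svs R r F) (Some x) * ln (pmf (svs R r F) (Some x)))"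

definition svs_average_entropy :: "('a, 'b) ring_scheme \<Rightarrow> nat \<Rightarrow> nat \<Rightarrow> real" where
  "svs_average_entropy R r d =
     1 / real (card (mpolys_deg_le R r d)) * (\<Sum>F\<in>mpolys_deg_le R r d. svs_entropy R r F)"

text \<open>
  Fields are records \<open>R :: 'a ring\<close> rather than types of class \<^class>\<open>field\<close>, so that an estimate
  uniform in the field can quantify over \<open>R\<close> inside the formula, after the error term has been chosen.
  Every finite field is isomorphic to one with carrier in \<^typ>\<open>nat\<close>, so for \<open>'a = nat\<close> such a
  quantification covers all finite fields at once.
\<close>

end

theory Submission
  imports Defs
begin

text \<open>
  Write \<open>Q = q\<^sup>r\<^sup>-\<^sup>1\<close>, let \<open>N\<^sub>a\<close> be the number of zeros of \<open>F\<close> on the vertical strip over \<open>a\<close>, and let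
  \<open>NS\<close> be the number of strips that contain a zero. The search outputs a zero over \<open>a\<close> with
  probability \<open>1 / (NS N\<^sub>a)\<close>. Hence \<open>H\<^sub>F\<close> is at least \<open>ln NS\<close> and, by Jensen's inequality, at least
  \<open>2 ln NS - ln V\<close> with \<open>V = \<Sum> 1 / N\<^sub>a\<close>, while \<open>NS \<ge> |Z(F)|\<^sup>2 / W\<close> with \<open>W = \<Sum> N\<^sub>a\<^sup>2\<close> by Cauchy-Schwarz.
  The values of a random \<open>F\<close> at any \<open>d + 1\<close> distinct points are independent and uniform, so \<open>|Z(F)|\<close> has mean
  \<open>Q\<close> and variance at most \<open>Q\<close>, and \<open>W\<close> has mean at most \<open>2 Q\<close>; thus \<open>ln NS\<close> is on average
  at least \<open>ln (Q / 2)\<close> up to \<open>O(ln Q / q)\<close>. For \<open>d \<ge> 3\<close> this suffices, because \<open>1 / (2 \<mu>\<^sub>d) \<le> 4 / 5\<close> leaves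
  room for the constant \<open>ln 2\<close>. For \<open>d = 2\<close>, where \<open>1 / (2 \<mu>\<^sub>d) = 1\<close>, the loss of \<open>ln 2\<close> is made up by \<open>V\<close>,
  whose mean is \<open>Q / 4\<close> up to a factor \<open>1 + O(1 / q)\<close>.
\<close>

section \<open>Evaluation of polynomials of bounded degree\<close>

text \<open>\<open>mpoly_eval\<close> sums over the support of \<open>F\<close>, which changes with
  \<open>F\<close>. This finite superset of all supports is the common index set on which evaluation
  becomes linear in the coefficients.\<close>

definition monoms_deg_le :: "nat \<Rightarrow> nat \<Rightarrow> nat multiset set" where
  "monoms_deg_le r d = {m. set_mset m \<subseteq> {..<r} \<and> size m \<le> d}"

definition monom_eval :: "('a, 'b) ring_scheme \<Rightarrow> 'a list \<Rightarrow> nat multiset \<Rightarrow> 'a" where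
  "monom_eval R xs m = finprod R (\<lambda>i. (xs ! i) [^]\<^bsub>R\<^esub> count m i) (set_mset m)"

lemma finite_monoms_deg_le: "finite (monoms_deg_le r d)"
proof -
  have "monoms_deg_le r d \<subseteq> mset ` {xs. set xs \<subseteq> {..<r} \<and> length xs \<le> d}"
  proof
    fix m assume m: "m \<in> monoms_deg_le r d"
    obtain xs where "m = mset xs" using ex_mset by metis
    with m show "m \<in> mset ` {xs. set xs \<subseteq> {..<r} \<and> length xs \<le> d}"
      by (auto simp: monoms_deg_le_def)
  qed
  thus ?thesis
    by (rule finite_subset) (intro finite_imageI finite_lists_length_le, simp)
qed

text \<open>Only \<open>indexed_pmult\<close> introduces variables, and its index lies in
  \<open>I\<close>. Together with the degree bound this confines supports to a finite set.\<close>

lemma (in ring) indexed_pset_support: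
  assumes "P \<in> indexed_pset I K" "P m \<noteq> \<zero>"
  shows "set_mset m \<subseteq> I"
  using assms
proof (induction arbitrary: m)
  case (indexed_const k)
  thus ?case by (auto simp: indexed_const_def split: if_splits)
next
  case (indexed_padd P Q)
  hence "P m \<noteq> \<zero> \<or> Q m \<noteq> \<zero>" by (auto simp: indexed_padd_def)
  thus ?case using indexed_padd by blast
next
  case (indexed_pmult P i)
  hence im: "i \<in># m" and "P (m - {#i#}) \<noteq> \<zero>" by (auto simp: indexed_pmult_def split: if_splits)
  hence "set_mset (m - {#i#}) \<subseteq> I" using indexed_pmult by blast
  moreover have "m = add_mset i (m - {#i#})" using im by simp
  ultimately show ?case using \<open>i \<in> I\<close> by (metis insert_subset set_mset_add_mset_insert)
qed

text \<open>\<open>indexed_pset\<close> has no constructor for scaling, but multiplication by a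
  constant passes through each of its three constructors.\<close>

lemma (in cring) indexed_pset_scale:
  assumes "c \<in> carrier R" "P \<in> indexed_pset I (carrier R)"
  shows "(\<lambda>m. c \<otimes> P m) \<in> indexed_pset I (carrier R)"
  using assms(2)
proof induction
  case (indexed_const k)
  have "(\<lambda>m::'c multiset. c \<otimes> indexed_const k m) = indexed_const (c \<otimes> k)"
    using assms(1) by (auto simp: indexed_const_def)
  thus ?case using indexed_const assms(1) by (simp add: indexed_pset.indexed_const)
next
  case (indexed_padd P Q)
  have "P m \<in> carrier R" "Q m \<in> carrier R" for m
    using indexed_padd indexed_pset_in_carrier[of "carrier R"] carrier_coeffE by auto
  hence "(\<lambda>m. c \<otimes> indexed_padd P Q m) = indexed_padd (\<lambda>m. c \<otimes> P m) (\<lambda>m. c \<otimes> Q m)"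
    using assms(1) by (auto simp: indexed_padd_def r_distr)
  thus ?case using indexed_padd by (simp add: indexed_pset.indexed_padd)
next
  case (indexed_pmult P i)
  have "(\<lambda>m. c \<otimes> indexed_pmult P i m) = indexed_pmult (\<lambda>m. c \<otimes> P m) i"
    using assms(1) by (auto simp: indexed_pmult_def)
  thus ?case using indexed_pmult by (simp add: indexed_pset.indexed_pmult)
qed

lemma (in ring) mpolys_deg_leD:
  assumes "F \<in> mpolys_deg_le R r d"
  shows "F m \<in> carrier R" "m \<notin> monoms_deg_le r d \<Longrightarrow> F m = \<zero>"
proof -
  have F: "F \<in> indexed_pset {..<r} (carrier R)" "\<And>m. F m \<noteq> \<zero> \<Longrightarrow> size m \<le> d"
    using assms by (auto simp: mpolys_deg_le_def)
  show "F m \<in> carrier R"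
    using F(1) indexed_pset_in_carrier carrier_coeffE by blast
  show "m \<notin> monoms_deg_le r d \<Longrightarrow> F m = \<zero>"
    using indexed_pset_support[OF F(1)] F(2) by (auto simp: monoms_deg_le_def)
qed

lemma (in ring) mpolys_deg_le_padd:
  assumes "F \<in> mpolys_deg_le R r d" "G \<in> mpolys_deg_le R r d"
  shows "indexed_padd F G \<in> mpolys_deg_le R r d"
proof -
  have "size m \<le> d" if "indexed_padd F G m \<noteq> \<zero>" for m
  proof -
    have "F m \<noteq> \<zero> \<or> G m \<noteq> \<zero>" using that by (auto simp: indexed_padd_def)
    thus ?thesis using assms by (auto simp: mpolys_deg_le_def)
  qed
  thus ?thesis using assms by (auto simp: mpolys_deg_le_def intro: indexed_pset.indexed_padd)
qed

lemma (in cring) mpolys_deg_le_scale: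
  assumes "c \<in> carrier R" "F \<in> mpolys_deg_le R r d"
  shows "(\<lambda>m. c \<otimes> F m) \<in> mpolys_deg_le R r d"
proof -
  have "size m \<le> d" if "c \<otimes> F m \<noteq> \<zero>" for m
  proof -
    have "F m \<noteq> \<zero>" using that assms by auto
    thus ?thesis using assms by (auto simp: mpolys_deg_le_def)
  qed
  thus ?thesis using assms indexed_pset_scale by (auto simp: mpolys_deg_le_def)
qed

lemma (in ring) mpolys_deg_le_pmult:
  assumes "F \<in> mpolys_deg_le R r d" "i < r"
  shows "indexed_pmult F i \<in> mpolys_deg_le R r (Suc d)"
proof -
  have "size m \<le> Suc d" if "indexed_pmult F i m \<noteq> \<zero>" for m
  proof -
    have "i \<in># m" "F (m - {#i#}) \<noteq> \<zero>" using that by (auto simp: indexed_pmult_def split: if_splits)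
    moreover from this have "size (m - {#i#}) \<le> d" using assms by (auto simp: mpolys_deg_le_def)
    ultimately show ?thesis by (simp add: size_Diff_singleton)
  qed
  thus ?thesis using assms by (auto simp: mpolys_deg_le_def intro: indexed_pset.indexed_pmult)
qed

lemma (in ring) mpolys_deg_le_const:
  "c \<in> carrier R \<Longrightarrow> indexed_const c \<in> mpolys_deg_le R r d"
  by (auto simp: mpolys_deg_le_def indexed_const_def
      intro: indexed_pset.indexed_const[unfolded indexed_const_def])

lemma (in ring) mpolys_deg_le_mono:
  "d \<le> d' \<Longrightarrow> mpolys_deg_le R r d \<subseteq> mpolys_deg_le R r d'"
  by (fastforce simp: mpolys_deg_le_def)

lemma (in ring) finite_mpolys_deg_le:
  assumes "finite (carrier R)"
  shows "finite (mpolys_deg_le R r d)"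
proof (rule finite_subset)
  show "mpolys_deg_le R r d \<subseteq> {F. \<forall>m. (m \<in> monoms_deg_le r d \<longrightarrow> F m \<in> carrier R) \<and>
          (m \<notin> monoms_deg_le r d \<longrightarrow> F m = \<zero>)}"
    using mpolys_deg_leD by auto
  show "finite {F. \<forall>m. (m \<in> monoms_deg_le r d \<longrightarrow> F m \<in> carrier R) \<and>
          (m \<notin> monoms_deg_le r d \<longrightarrow> F m = \<zero>)}"
    by (intro finite_set_of_finite_funs finite_monoms_deg_le assms)
qed

section \<open>Evaluation: linearity and multiplication by a variable\<close>

lemma (in cring) monom_eval_closed:
  assumes "xs \<in> affine_space R r" "set_mset m \<subseteq> {..<r}"
  shows "monom_eval R xs m \<in> carrier R"
  using assms unfolding monom_eval_def affine_space_def
  by (intro finprod_closed) (auto intro!: nat_pow_closed simp: subset_iff)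

text \<open>Variables absent from \<open>m\<close> contribute a zeroth power, that is
  \<open>\<one>\<close>. A product range shared by all monomials allows factorwise
  comparison.\<close>

lemma (in cring) monom_eval_eq:
  assumes "xs \<in> affine_space R r" "set_mset m \<subseteq> {..<r}"
  shows "monom_eval R xs m = finprod R (\<lambda>i. (xs ! i) [^] count m i) {..<r}"
  unfolding monom_eval_def using assms
  by (intro finprod_mono_neutral_cong_left)
     (auto intro!: nat_pow_closed simp: affine_space_def subset_iff not_in_iff)

lemma (in cring) monom_eval_add_mset:
  assumes xs: "xs \<in> affine_space R r" and m: "set_mset m \<subseteq> {..<r}" and i: "i < r"
  shows "monom_eval R xs (add_mset i m) = xs ! i \<otimes> monom_eval R xs m"
proof -
  have x: "xs ! j \<in> carrier R" if "j < r" for j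
    using xs that by (auto simp: affine_space_def subset_iff)
  have "monom_eval R xs (add_mset i m) =
          finprod R (\<lambda>j. (xs ! j) [^] count (add_mset i m) j) {..<r}"
    using m i by (intro monom_eval_eq[OF xs]) auto
  also have "\<dots> = finprod R (\<lambda>j. (if i = j then xs ! j else \<one>) \<otimes> (xs ! j) [^] count m j) {..<r}"
    using x by (intro finprod_cong') (auto simp: m_comm)
  also have "\<dots> = finprod R (\<lambda>j. if i = j then xs ! j else \<one>) {..<r} \<otimes> monom_eval R xs m"
    unfolding monom_eval_eq[OF xs m] using x by (intro finprod_multf) auto
  also have "finprod R (\<lambda>j. if i = j then xs ! j else \<one>) {..<r} = xs ! i"
    using i x by (intro finprod_singleton) auto
  finally show ?thesis .
qed

lemma (in cring) mpoly_eval_eq: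
  assumes F: "F \<in> mpolys_deg_le R r d" and xs: "xs \<in> affine_space R r"
  shows "mpoly_eval R F xs = (\<Oplus>m\<in>monoms_deg_le r d. F m \<otimes> monom_eval R xs m)"
  unfolding mpoly_eval_def monom_eval_def[symmetric]
  using mpolys_deg_leD[OF F] monom_eval_closed[OF xs] finite_monoms_deg_le
  by (intro add.finprod_mono_neutral_cong_left) (auto simp: monoms_deg_le_def)

lemma (in cring) mpoly_eval_closed:
  assumes "F \<in> mpolys_deg_le R r d" "xs \<in> affine_space R r"
  shows "mpoly_eval R F xs \<in> carrier R"
  unfolding mpoly_eval_eq[OF assms]
  using mpolys_deg_leD[OF assms(1)] monom_eval_closed[OF assms(2)]
  by (intro finsum_closed) (auto simp: monoms_deg_le_def)

lemma (in cring) mpoly_eval_padd: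
  assumes F: "F \<in> mpolys_deg_le R r d" and G: "G \<in> mpolys_deg_le R r d"
    and xs: "xs \<in> affine_space R r"
  shows "mpoly_eval R (indexed_padd F G) xs = mpoly_eval R F xs \<oplus> mpoly_eval R G xs"
proof -
  note c = mpolys_deg_leD[OF F] mpolys_deg_leD[OF G] monom_eval_closed[OF xs]
  have "mpoly_eval R (indexed_padd F G) xs =
          (\<Oplus>m\<in>monoms_deg_le r d. F m \<otimes> monom_eval R xs m \<oplus> G m \<otimes> monom_eval R xs m)"
    unfolding mpoly_eval_eq[OF mpolys_deg_le_padd[OF F G] xs] using c
    by (intro finsum_cong') (auto simp: indexed_padd_def monoms_deg_le_def l_distr)
  also have "\<dots> = mpoly_eval R F xs \<oplus> mpoly_eval R G xs"
    unfolding mpoly_eval_eq[OF F xs] mpoly_eval_eq[OF G xs] using c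
    by (intro finsum_addf) (auto simp: monoms_deg_le_def)
  finally show ?thesis .
qed

lemma (in cring) mpoly_eval_scale:
  assumes F: "F \<in> mpolys_deg_le R r d" and c: "c \<in> carrier R"
    and xs: "xs \<in> affine_space R r"
  shows "mpoly_eval R (\<lambda>m. c \<otimes> F m) xs = c \<otimes> mpoly_eval R F xs"
proof -
  note cl = mpolys_deg_leD[OF F] monom_eval_closed[OF xs]
  have "c \<otimes> mpoly_eval R F xs = (\<Oplus>m\<in>monoms_deg_le r d. c \<otimes> (F m \<otimes> monom_eval R xs m))"
    unfolding mpoly_eval_eq[OF F xs] using cl c
    by (intro finsum_rdistr) (auto simp: monoms_deg_le_def finite_monoms_deg_le[unfolded monoms_deg_le_def])
  also have "\<dots> = mpoly_eval R (\<lambda>m. c \<otimes> F m) xs"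
    unfolding mpoly_eval_eq[OF mpolys_deg_le_scale[OF c F] xs] using cl c
    by (intro finsum_cong') (auto simp: monoms_deg_le_def m_assoc)
  finally show ?thesis by simp
qed

text \<open>Only monomials containing \<open>i\<close> have nonzero coefficients in the product.
  They are the images of \<open>monoms_deg_le r d\<close> under the injective map
  \<open>add_mset i\<close>, along which the sum is reindexed.\<close>

lemma (in cring) mpoly_eval_pmult:
  assumes F: "F \<in> mpolys_deg_le R r d" and i: "i < r" and xs: "xs \<in> affine_space R r"
  shows "mpoly_eval R (indexed_pmult F i) xs = xs ! i \<otimes> mpoly_eval R F xs"
proof -
  note cl = mpolys_deg_leD[OF F] monom_eval_closed[OF xs]
  have x: "xs ! i \<in> carrier R"
    using xs i by (auto simp: affine_space_def subset_iff)
  let ?h = "\<lambda>m. indexed_pmult F i m \<otimes> monom_eval R xs m"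
  have "mpoly_eval R (indexed_pmult F i) xs = (\<Oplus>m\<in>monoms_deg_le r (Suc d). ?h m)"
    by (rule mpoly_eval_eq[OF mpolys_deg_le_pmult[OF F i] xs])
  also have "\<dots> = (\<Oplus>m\<in>add_mset i ` monoms_deg_le r d. ?h m)"
  proof (rule add.finprod_mono_neutral_cong_right)
    show "?h m = \<zero>" if "m \<in> monoms_deg_le r (Suc d) - add_mset i ` monoms_deg_le r d" for m
    proof -
      have "i \<notin># m"
      proof
        assume "i \<in># m"
        then obtain m' where "m = add_mset i m'" by (metis mset_add)
        with that show False by (auto simp: monoms_deg_le_def)
      qed
      thus ?thesis using that cl by (auto simp: indexed_pmult_def monoms_deg_le_def)
    qed
  qed (use i cl finite_monoms_deg_le in \<open>auto simp: monoms_deg_le_def indexed_pmult_def\<close>)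
  also have "\<dots> = (\<Oplus>m\<in>monoms_deg_le r d. ?h (add_mset i m))"
    using cl i by (intro finsum_reindex)
       (auto simp: indexed_pmult_def monoms_deg_le_def intro!: inj_onI)
  also have "\<dots> = (\<Oplus>m\<in>monoms_deg_le r d. xs ! i \<otimes> (F m \<otimes> monom_eval R xs m))"
    using cl i x
    by (intro finsum_cong')
       (auto simp: indexed_pmult_def monoms_deg_le_def monom_eval_add_mset[OF xs] m_lcomm)
  also have "\<dots> = xs ! i \<otimes> mpoly_eval R F xs"
    unfolding mpoly_eval_eq[OF F xs] using cl x
    by (intro finsum_rdistr[symmetric])
       (auto simp: monoms_deg_le_def finite_monoms_deg_le[unfolded monoms_deg_le_def])
  finally show ?thesis .
qed

lemma (in cring) mpoly_eval_const:
  assumes "c \<in> carrier R" "xs \<in> affine_space R r"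
  shows "mpoly_eval R (indexed_const c) xs = c"
proof -
  have "monoms_deg_le r 0 = {{#}}" by (auto simp: monoms_deg_le_def)
  thus ?thesis
    using assms mpoly_eval_eq[OF mpolys_deg_le_const[OF assms(1), of r 0] assms(2)]
    by (simp add: indexed_const_def monom_eval_def)
qed

section \<open>Independence of the values at few points\<close>

text \<open>The witness is a product of affine linear factors (X_i - s_i) / (p_i - s_i), one for
  each point s of \<open>T\<close>, where i is a coordinate in which p and s differ. Hence the
  degree bound is the number of points.\<close>

lemma (in field) mpoly_interpolate:
  assumes "finite T" "T \<subseteq> affine_space R r" "p \<in> affine_space R r - T"
  shows "\<exists>G\<in>mpolys_deg_le R r (card T).
           (\<forall>t\<in>T. mpoly_eval R G t = \<zero>) \<and> mpoly_eval R G p = \<one>"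
  using assms
proof (induction T)
  case empty
  thus ?case using mpoly_eval_const[of \<one> p r] mpolys_deg_le_const[of \<one> r 0] by auto
next
  case (insert s T)
  then obtain G where G: "G \<in> mpolys_deg_le R r (card T)"
    "\<forall>t\<in>T. mpoly_eval R G t = \<zero>" "mpoly_eval R G p = \<one>" by auto
  have s: "s \<in> affine_space R r" and p: "p \<in> affine_space R r" using insert.prems by auto
  have "\<exists>i<r. p ! i \<noteq> s ! i"
    using insert.prems by (auto simp: affine_space_def list_eq_iff_nth_eq)
  then obtain i where i: "i < r" "p ! i \<noteq> s ! i" by auto
  have [simp]: "t ! i \<in> carrier R" if "t \<in> affine_space R r" for t
    using that i by (auto simp: affine_space_def subset_iff)
  define c where "c = inv (p ! i \<ominus> s ! i)"
  have ne: "p ! i \<ominus> s ! i \<noteq> \<zero>" using i s p by (simp add: minus_equality r_right_minus_eq)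
  hence "p ! i \<ominus> s ! i \<in> Units R" using s p i(1) unfolding field_Units by simp
  hence c: "c \<in> carrier R" "c \<otimes> (p ! i \<ominus> s ! i) = \<one>"
    by (simp_all add: c_def)
  define G0 where "G0 = indexed_padd (indexed_pmult G i) (\<lambda>m. (\<ominus> (s ! i)) \<otimes> G m)"
  have G0: "indexed_pmult G i \<in> mpolys_deg_le R r (Suc (card T))"
     "(\<lambda>m. (\<ominus> (s ! i)) \<otimes> G m) \<in> mpolys_deg_le R r (Suc (card T))"
    using mpolys_deg_le_pmult[OF G(1) i(1)]
      subsetD[OF mpolys_deg_le_mono mpolys_deg_le_scale[OF _ G(1)]] s by auto
  hence G0': "G0 \<in> mpolys_deg_le R r (Suc (card T))"
    unfolding G0_def by (rule mpolys_deg_le_padd)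
  have ev: "mpoly_eval R (\<lambda>m. c \<otimes> G0 m) t = c \<otimes> ((t ! i \<ominus> s ! i) \<otimes> mpoly_eval R G t)"
    if t: "t \<in> affine_space R r" for t
  proof -
    have "mpoly_eval R G0 t = t ! i \<otimes> mpoly_eval R G t \<oplus> (\<ominus> (s ! i)) \<otimes> mpoly_eval R G t"
      unfolding G0_def mpoly_eval_padd[OF G0 t] mpoly_eval_pmult[OF G(1) i(1) t]
      using mpoly_eval_scale[OF G(1) _ t] s by simp
    also have "\<dots> = (t ! i \<ominus> s ! i) \<otimes> mpoly_eval R G t"
      using s t mpoly_eval_closed[OF G(1) t] by (simp add: a_minus_def l_distr)
    finally show ?thesis using mpoly_eval_scale[OF G0' c(1) t] by simp
  qed
  show ?case
  proof (intro bexI conjI ballI)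
    show "(\<lambda>m. c \<otimes> G0 m) \<in> mpolys_deg_le R r (card (insert s T))"
      using mpolys_deg_le_scale[OF c(1) G0'] insert.hyps by simp
    show "mpoly_eval R (\<lambda>m. c \<otimes> G0 m) p = \<one>"
      using ev[OF p] G(3) c s p by simp
    fix t assume "t \<in> insert s T"
    thus "mpoly_eval R (\<lambda>m. c \<otimes> G0 m) t = \<zero>"
      unfolding insert_iff
    proof
      assume "t = s"
      thus ?thesis using ev[OF s] c s mpoly_eval_closed[OF G(1) s]
        by (simp add: a_minus_def r_neg)
    next
      assume "t \<in> T"
      moreover from this have "t \<in> affine_space R r" using insert.prems by auto
      ultimately show ?thesis using ev[of t] G(2) c s by simp
    qed
  qed
qed

text \<open>Adding multiples of an interpolating polynomial shifts the value at a new point and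
  keeps the zeros on \<open>T\<close>, so all values there are equally frequent and each further
  point divides the count by q. The degree of that polynomial is bounded by the number of earlier
  points, which must not exceed \<open>d\<close>; hence the bound \<open>Suc d\<close>.\<close>

lemma (in field) card_mpolys_vanishing:
  assumes fin: "finite (carrier R)"
    and "finite T" "T \<subseteq> affine_space R r" "card T \<le> Suc d"
  shows "card {F \<in> mpolys_deg_le R r d. \<forall>t\<in>T. mpoly_eval R F t = \<zero>} * card (carrier R) ^ card T
           = card (mpolys_deg_le R r d)"
  using assms(2-)
proof (induction T)
  case empty
  thus ?case by simp
next
  case (insert p T)
  let ?S = "mpolys_deg_le R r d"
  let ?A = "{F \<in> ?S. \<forall>t\<in>T. mpoly_eval R F t = \<zero>}"
  let ?B = "\<lambda>v. {F \<in> ?A. mpoly_eval R F p = v}"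
  have p: "p \<in> affine_space R r" using insert.prems by simp
  have finS: "finite ?S" by (rule finite_mpolys_deg_le[OF fin])
  obtain G where G: "G \<in> mpolys_deg_le R r (card T)"
    "\<forall>t\<in>T. mpoly_eval R G t = \<zero>" "mpoly_eval R G p = \<one>"
    using mpoly_interpolate[of T r p] insert by auto
  have GS: "G \<in> ?S" using G(1) mpolys_deg_le_mono[of "card T" d r] insert by auto
  \<comment> \<open>Translation by (w - v) G carries the fibre over \<open>v\<close> injectively
    into the fibre over \<open>w\<close>; exchanging \<open>v\<close> and \<open>w\<close> then
    gives equality.\<close>
  have le: "card (?B v) \<le> card (?B w)" if v: "v \<in> carrier R" and w: "w \<in> carrier R" for v w
  proof (rule card_inj_on_le)
    define c where "c = w \<ominus> v"
    have c: "c \<in> carrier R" using v w by (simp add: c_def)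
    let ?H = "\<lambda>m. c \<otimes> G m"
    have H: "?H \<in> ?S" using mpolys_deg_le_scale[OF c GS] .
    show "inj_on (\<lambda>F. indexed_padd F ?H) (?B v)"
    proof (rule inj_onI, rule ext)
      fix F F' m assume FF: "F \<in> ?B v" "F' \<in> ?B v" "indexed_padd F ?H = indexed_padd F' ?H"
      from fun_cong[OF FF(3), of m] show "F m = F' m"
        using FF(1,2) mpolys_deg_leD(1)[of F r d m] mpolys_deg_leD(1)[of F' r d m]
          mpolys_deg_leD(1)[OF H] by (auto simp: indexed_padd_def)
    qed
    show "(\<lambda>F. indexed_padd F ?H) ` ?B v \<subseteq> ?B w"
    proof safe
      fix F assume F: "F \<in> ?S" "\<forall>t\<in>T. mpoly_eval R F t = \<zero>" and vv: "v = mpoly_eval R F p"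
      show "indexed_padd F ?H \<in> ?S" by (rule mpolys_deg_le_padd[OF F(1) H])
      have *: "mpoly_eval R (indexed_padd F ?H) t = mpoly_eval R F t \<oplus> c \<otimes> mpoly_eval R G t"
        if "t \<in> affine_space R r" for t
        using mpoly_eval_padd[OF F(1) H that] mpoly_eval_scale[OF GS c that] by simp
      show "mpoly_eval R (indexed_padd F ?H) t = \<zero>" if "t \<in> T" for t
        using *[of t] that insert.prems F(2) G(2) c by auto
      have "v \<oplus> c = w"
        using v w by (simp add: c_def a_minus_def a_lcomm[of v w] r_neg)
      thus "mpoly_eval R (indexed_padd F ?H) p = w"
        using *[OF p] G(3) vv c by simp
    qed
    show "finite (?B w)" using finS by simp
  qed
  have eq: "card (?B v) = card (?B \<zero>)" if "v \<in> carrier R" for v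
    using le[OF that zero_closed] le[OF zero_closed that] by simp
  have "?A = (\<Union>v\<in>carrier R. ?B v)"
    using mpoly_eval_closed[OF _ p] by auto
  also have "card \<dots> = (\<Sum>v\<in>carrier R. card (?B v))"
    using finS fin by (intro card_UN_disjoint) auto
  also have "\<dots> = (\<Sum>v\<in>carrier R. card (?B \<zero>))" by (rule sum.cong[OF refl eq])
  also have "\<dots> = card (carrier R) * card (?B \<zero>)" by simp
  finally have A: "card ?A = card (carrier R) * card (?B \<zero>)" .
  have B: "{F \<in> ?S. \<forall>t\<in>insert p T. mpoly_eval R F t = \<zero>} = ?B \<zero>" by blast
  have "card ?A * card (carrier R) ^ card T = card ?S"
    by (rule insert.IH) (use insert.prems insert.hyps in auto)
  moreover have "card (insert p T) = Suc (card T)" using insert.hyps by simp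
  ultimately show ?case unfolding A B by (simp only: power_Suc ac_simps)
qed

section \<open>Entropy of the search\<close>

lemma finite_affine_space: "finite (carrier R) \<Longrightarrow> finite (affine_space R n)"
  using finite_lists_length_eq[of "carrier R" n] by (simp add: affine_space_def conj_commute)

lemma card_affine_space: "finite (carrier R) \<Longrightarrow> card (affine_space R n) = card (carrier R) ^ n"
  using card_lists_length_eq[of "carrier R" n] by (simp add: affine_space_def conj_commute)

lemma append_in_affine_space_iff:
  "a @ [x] \<in> affine_space R (Suc n) \<longleftrightarrow> a \<in> affine_space R n \<and> x \<in> carrier R"
  by (auto simp: affine_space_def)

lemma affine_space_Suc:
  "affine_space R (Suc n) = (\<lambda>(a, x). a @ [x]) ` (affine_space R n \<times> carrier R)"
proof
  show "affine_space R (Suc n) \<subseteq> (\<lambda>(a, x). a @ [x]) ` (affine_space R n \<times> carrier R)"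
  proof
    fix p assume p: "p \<in> affine_space R (Suc n)"
    then obtain a x where "p = a @ [x]"
      by (cases p rule: rev_cases) (auto simp: affine_space_def)
    thus "p \<in> (\<lambda>(a, x). a @ [x]) ` (affine_space R n \<times> carrier R)"
      using p by (auto simp: append_in_affine_space_iff image_iff)
  qed
qed (auto simp: append_in_affine_space_iff)

lemma inj_append_singleton: "inj_on (\<lambda>(a, x). a @ [x]) S"
  by (auto simp: inj_on_def)

lemma finite_strip_zeros: "finite (carrier R) \<Longrightarrow> finite (strip_zeros R F a)"
  by (simp add: strip_zeros_def)

text \<open>Induction over the shrinking set of remaining strips, hence an arbitrary
  \<open>A\<close>. The draw hits \<open>a\<close> and succeeds with the reciprocal of its number of
  zeros, or hits another strip with zeros and gives 0, or hits an empty strip, whose removal leaves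
  the number of strips with zeros unchanged.\<close>

lemma pmf_svs_search:
  assumes fin: "finite (carrier R)" and "finite A" "a \<in> A" and x: "x \<in> strip_zeros R F a"
  shows "pmf (svs_search R F A) (Some (a @ [x])) =
           1 / (real (card {a\<in>A. strip_zeros R F a \<noteq> {}}) * real (card (strip_zeros R F a)))"
  using assms(2,3)
proof (induction A rule: finite_psubset_induct)
  case (psubset A)
  let ?G = "\<lambda>A. {a\<in>A. strip_zeros R F a \<noteq> {}}"
  let ?N = "real (card (?G A))" and ?n = "real (card (strip_zeros R F a))"
  let ?f = "\<lambda>b. if strip_zeros R F b \<noteq> {}
          then map_pmf (\<lambda>x. Some (b @ [x])) (pmf_of_set (strip_zeros R F b))
          else svs_search R F (A - {b})"
  have aG: "a \<in> ?G A" using psubset.prems x by auto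
  hence N: "?N > 0" using psubset.hyps by (auto simp: card_gt_0_iff)
  have n: "?n > 0" using x finite_strip_zeros[OF fin] by (auto simp: card_gt_0_iff)
  have A: "A \<noteq> {}" "real (card A) > 0" using psubset by (auto simp: card_gt_0_iff)
  have step: "pmf (?f b) (Some (a @ [x])) =
      (if b = a then 1 / ?n else 0) + (if strip_zeros R F b = {} then 1 / (?N * ?n) else 0)"
    if b: "b \<in> A" for b
  proof -
    consider "b = a" | "b \<noteq> a" "strip_zeros R F b \<noteq> {}" | "b \<noteq> a" "strip_zeros R F b = {}"
      by blast
    thus ?thesis
    proof cases
      case 1
      have "inj (\<lambda>x. Some (a @ [x]))" by (auto simp: inj_on_def)
      from pmf_map_inj'[OF this, of "pmf_of_set (strip_zeros R F a)" x]
      have "pmf (map_pmf (\<lambda>x. Some (a @ [x])) (pmf_of_set (strip_zeros R F a))) (Some (a @ [x]))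
              = 1 / ?n"
        using x finite_strip_zeros[OF fin] by (subst (asm) pmf_of_set) auto
      thus ?thesis using 1 x by auto
    next
      case 2
      thus ?thesis by (auto intro!: pmf_map_outside)
    next
      case 3
      have "?G (A - {b}) = ?G A" using 3 by auto
      moreover have "pmf (svs_search R F (A - {b})) (Some (a @ [x])) =
          1 / (real (card (?G (A - {b}))) * ?n)"
        using b 3 psubset.prems by (intro psubset.IH) auto
      ultimately show ?thesis using 3 by simp
    qed
  qed
  have card_bad: "real (card {b\<in>A. strip_zeros R F b = {}}) = real (card A) - ?N"
  proof -
    have "A = ?G A \<union> {b\<in>A. strip_zeros R F b = {}}" by auto
    hence "card A = card (?G A) + card {b\<in>A. strip_zeros R F b = {}}"
      using psubset.hyps by (subst card_Un_disjoint[symmetric]) auto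
    thus ?thesis by simp
  qed
  have "svs_search R F A = bind_pmf (pmf_of_set A) ?f"
    using A psubset.hyps by (subst svs_search.simps) simp
  hence "pmf (svs_search R F A) (Some (a @ [x])) =
           (\<Sum>b\<in>A. pmf (?f b) (Some (a @ [x]))) / real (card A)"
    using pmf_bind_pmf_of_set[OF A(1) psubset.hyps(1), of ?f] by simp
  also have "(\<Sum>b\<in>A. pmf (?f b) (Some (a @ [x]))) =
      (\<Sum>b\<in>A. (if b = a then 1 / ?n else 0) + (if strip_zeros R F b = {} then 1 / (?N * ?n) else 0))"
    by (rule sum.cong[OF refl step])
  also have "\<dots> = 1 / ?n + real (card {b\<in>A. strip_zeros R F b = {}}) * (1 / (?N * ?n))"
    using psubset.prems psubset.hyps
    by (simp add: sum.distrib sum.If_cases Int_def)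
  \<comment> \<open>Here 1/n + (|A| - N)/(N n) = |A|/(N n), and |A| cancels against the uniform
    draw.\<close>
  also have "\<dots> = real (card A) / (?N * ?n)"
    unfolding card_bad using N n by (simp add: field_simps)
  finally show ?case using A by simp
qed

text \<open>Its cardinality is the \<open>NS\<close> of the overview, with \<open>n\<close> standing
  for \<open>r - 1\<close>; writing \<open>r\<close> as \<open>Suc n\<close> in the entropy formulas
  avoids truncated subtraction.\<close>

definition good_strips :: "('a, 'b) ring_scheme \<Rightarrow> nat \<Rightarrow> (nat multiset \<Rightarrow> 'a) \<Rightarrow> 'a list set" where
  "good_strips R n F = {a \<in> affine_space R n. strip_zeros R F a \<noteq> {}}"

lemma finite_good_strips: "finite (carrier R) \<Longrightarrow> finite (good_strips R n F)"
  by (simp add: good_strips_def finite_affine_space)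

lemma card_strip_zeros_pos:
  "finite (carrier R) \<Longrightarrow> a \<in> good_strips R n F \<Longrightarrow> card (strip_zeros R F a) > 0"
  by (simp add: good_strips_def card_gt_0_iff finite_strip_zeros)

lemma zero_set_Suc:
  "zero_set R (Suc n) F =
     (\<lambda>(a, x). a @ [x]) ` (SIGMA a:good_strips R n F. strip_zeros R F a)"
  by (auto simp: zero_set_def affine_space_Suc strip_zeros_def good_strips_def image_iff)

text \<open>All zeros over \<open>a\<close> have the same probability
  \<open>1 / (NS N\<^sub>a)\<close>, so their \<open>N\<^sub>a\<close> equal terms add up to
  \<open>ln (NS N\<^sub>a) / NS\<close>. Without any zero both sides are 0, as division by 0 gives
  0.\<close>

lemma svs_entropy_Suc:
  assumes fin: "finite (carrier R)"
  shows "svs_entropy R (Suc n) F =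
    (\<Sum>a\<in>good_strips R n F. ln (real (card (good_strips R n F)) * real (card (strip_zeros R F a))))
      / real (card (good_strips R n F))"
proof -
  let ?G = "good_strips R n F"
  let ?N = "real (card ?G)" and ?n = "\<lambda>a. real (card (strip_zeros R F a))"
  have p: "pmf (svs R (Suc n) F) (Some (a @ [x])) = 1 / (?N * ?n a)"
    if "a \<in> ?G" "x \<in> strip_zeros R F a" for a x
    using pmf_svs_search[OF fin finite_affine_space[OF fin], of a n x F] that
    by (simp add: svs_def good_strips_def)
  have "svs_entropy R (Suc n) F = (\<Sum>(a, x)\<in>(SIGMA a:?G. strip_zeros R F a).
          - pmf (svs R (Suc n) F) (Some (a @ [x])) * ln (pmf (svs R (Suc n) F) (Some (a @ [x]))))"
    unfolding svs_entropy_def zero_set_Suc sum.reindex[OF inj_append_singleton]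
    by (simp add: o_def case_prod_unfold)
  also have "\<dots> = (\<Sum>(a, x)\<in>(SIGMA a:?G. strip_zeros R F a). ln (?N * ?n a) / (?N * ?n a))"
  proof (rule sum.cong[OF refl], clarify)
    fix a x assume ax: "a \<in> ?G" "x \<in> strip_zeros R F a"
    have "?N > 0" using ax(1) finite_good_strips[OF fin, of n F] by (auto simp: card_gt_0_iff)
    moreover have "?n a > 0" using card_strip_zeros_pos[OF fin ax(1)] by simp
    ultimately have ln_inv: "ln (1 / (?N * ?n a)) = - ln (?N * ?n a)"
      by (auto simp: ln_div)
    show "- pmf (svs R (Suc n) F) (Some (a @ [x])) * ln (pmf (svs R (Suc n) F) (Some (a @ [x])))
            = ln (?N * ?n a) / (?N * ?n a)"
      unfolding p[OF ax] ln_inv by simp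
  qed
  also have "\<dots> = (\<Sum>a\<in>?G. \<Sum>x\<in>strip_zeros R F a. ln (?N * ?n a) / (?N * ?n a))"
    using finite_good_strips[OF fin] finite_strip_zeros[OF fin] by (subst sum.Sigma) auto
  also have "\<dots> = (\<Sum>a\<in>?G. ln (?N * ?n a) / ?N)"
    using card_strip_zeros_pos[OF fin] by (intro sum.cong) fastforce+
  finally show ?thesis by (simp add: sum_divide_distrib)
qed

section \<open>Lower bounds for the entropy of a single polynomial\<close>

lemma svs_entropy_nonneg: "svs_entropy R r F \<ge> 0"
  unfolding svs_entropy_def
proof (rule sum_nonneg)
  fix p
  let ?p = "pmf (svs R r F) (Some p)"
  have "ln ?p \<le> 0" by (cases "?p = 0") (simp_all add: pmf_le_1 pmf_pos)
  thus "- ?p * ln ?p \<ge> 0" by (simp add: mult_nonneg_nonpos)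
qed

text \<open>The logarithm is concave and lies below its tangent at \<open>m\<close>. Jensen's
  inequality, over the strips as well as over the polynomials, is applied through this
  bound.\<close>

lemma ln_le_tangent:
  fixes x m :: real
  assumes "x > 0" "m > 0"
  shows "ln x \<le> ln m + x / m - 1"
  using ln_le_minus_one[of "x / m"] assms by (simp add: ln_div)

text \<open>Each strip counted has at least one zero, so every logarithm in the entropy formula is
  at least \<open>ln NS\<close>. If there is no such strip, \<open>ln 0 = 0\<close> reduces the
  claim to nonnegativity.\<close>

lemma svs_entropy_ge_ln_card:
  assumes fin: "finite (carrier R)"
  shows "svs_entropy R (Suc n) F \<ge> ln (real (card (good_strips R n F)))"
proof (cases "good_strips R n F = {}")
  case True
  thus ?thesis by (simp add: svs_entropy_nonneg)
next
  case False
  let ?G = "good_strips R n F"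
  have N: "real (card ?G) > 0"
    using False finite_good_strips[OF fin] by (simp add: card_gt_0_iff)
  have "ln (real (card ?G)) \<le> ln (real (card ?G) * real (card (strip_zeros R F a)))"
    if "a \<in> ?G" for a
    using card_strip_zeros_pos[OF fin that] N by (subst ln_le_cancel_iff) auto
  hence "(\<Sum>a\<in>?G. ln (real (card ?G)))
      \<le> (\<Sum>a\<in>?G. ln (real (card ?G) * real (card (strip_zeros R F a))))"
    by (intro sum_mono) auto
  thus ?thesis unfolding svs_entropy_Suc[OF fin] using N by (simp add: field_simps)
qed

text \<open>The right-hand side is minus the logarithm of the collision probability.\<close>

lemma svs_entropy_ge_collision:
  assumes fin: "finite (carrier R)"
  shows "svs_entropy R (Suc n) F \<ge> 2 * ln (real (card (good_strips R n F)))
           - ln (\<Sum>a\<in>good_strips R n F. 1 / real (card (strip_zeros R F a)))"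
proof (cases "good_strips R n F = {}")
  case True
  thus ?thesis by (simp add: svs_entropy_nonneg)
next
  case False
  let ?G = "good_strips R n F" and ?n = "\<lambda>a. real (card (strip_zeros R F a))"
  let ?N = "real (card ?G)" and ?V = "\<Sum>a\<in>?G. 1 / ?n a"
  have N: "?N > 0"
    using False finite_good_strips[OF fin] by (simp add: card_gt_0_iff)
  have n: "?n a > 0" if "a \<in> ?G" for a using card_strip_zeros_pos[OF fin that] by simp
  have V: "?V > 0" using False finite_good_strips[OF fin] n by (intro sum_pos) auto
  \<comment> \<open>Tangent at \<open>?V / ?N\<^sup>2\<close>, the mean over the strips of
    \<open>1 / (?N * ?n a)\<close>; with this choice the constant 1 and the linear term cancel after
    summation.\<close>
  have "ln (?N * ?n a) \<ge> 2 * ln ?N - ln ?V + 1 - ?N / ?V * (1 / ?n a)" if a: "a \<in> ?G" for a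
  proof -
    have "ln (1 / (?N * ?n a)) \<le> ln (?V / ?N\<^sup>2) + (1 / (?N * ?n a)) / (?V / ?N\<^sup>2) - 1"
      using N V n[OF a] by (intro ln_le_tangent) auto
    moreover have "(1 / (?N * ?n a)) / (?V / ?N\<^sup>2) = ?N / ?V * (1 / ?n a)"
      using N V n[OF a] by (simp add: field_simps power2_eq_square)
    moreover have "ln (1 / (?N * ?n a)) = - ln (?N * ?n a)"
      using N n[OF a] by (simp add: ln_div)
    moreover have "ln (?V / ?N\<^sup>2) = ln ?V - 2 * ln ?N"
      using N V by (simp add: ln_div ln_realpow)
    ultimately show ?thesis by linarith
  qed
  hence "(\<Sum>a\<in>?G. 2 * ln ?N - ln ?V + 1 - ?N / ?V * (1 / ?n a)) \<le> (\<Sum>a\<in>?G. ln (?N * ?n a))"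
    by (intro sum_mono) auto
  moreover have "(\<Sum>a\<in>?G. 2 * ln ?N - ln ?V + 1 - ?N / ?V * (1 / ?n a))
      = ?N * (2 * ln ?N - ln ?V + 1) - ?N / ?V * ?V"
    by (simp only: sum_subtractf sum_distrib_left[symmetric] sum_constant)
  ultimately have "?N * (2 * ln ?N - ln ?V) \<le> (\<Sum>a\<in>?G. ln (?N * ?n a))"
    using V by (simp add: algebra_simps)
  thus ?thesis unfolding svs_entropy_Suc[OF fin] using N by (simp add: field_simps)
qed

lemma card_zero_set_Suc:
  assumes fin: "finite (carrier R)"
  shows "card (zero_set R (Suc n) F) = (\<Sum>a\<in>good_strips R n F. card (strip_zeros R F a))"
  unfolding zero_set_Suc card_image[OF inj_append_singleton]
  using finite_good_strips[OF fin] finite_strip_zeros[OF fin] by (subst card_SigmaI) auto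

lemma card_zero_set_square_le:
  assumes fin: "finite (carrier R)"
  shows "(real (card (zero_set R (Suc n) F)))\<^sup>2 \<le>
    real (card (good_strips R n F)) * (\<Sum>a\<in>good_strips R n F. (real (card (strip_zeros R F a)))\<^sup>2)"
  using Cauchy_Schwarz_ineq_sum[of "\<lambda>a. 1" "\<lambda>a. real (card (strip_zeros R F a))" "good_strips R n F"]
  by (simp add: card_zero_set_Suc[OF fin])

text \<open>The logarithm of the Cauchy-Schwarz bound. It survives the absence of zeros, since all
  three logarithms are then \<open>ln 0 = 0\<close>.\<close>

lemma ln_card_good_strips_ge:
  assumes fin: "finite (carrier R)"
  shows "ln (real (card (good_strips R n F))) \<ge> 2 * ln (real (card (zero_set R (Suc n) F)))
     - ln (\<Sum>a\<in>good_strips R n F. (real (card (strip_zeros R F a)))\<^sup>2)"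
proof (cases "good_strips R n F = {}")
  case True
  thus ?thesis by (simp add: card_zero_set_Suc[OF fin])
next
  case False
  let ?N = "real (card (good_strips R n F))" and ?Z = "real (card (zero_set R (Suc n) F))"
  let ?W = "\<Sum>a\<in>good_strips R n F. (real (card (strip_zeros R F a)))\<^sup>2"
  have N: "?N > 0"
    using False finite_good_strips[OF fin] by (simp add: card_gt_0_iff)
  have W: "?W > 0" using False finite_good_strips[OF fin] card_strip_zeros_pos[OF fin]
    by (intro sum_pos) force+
  have Z: "?Z > 0" using False finite_good_strips[OF fin] card_strip_zeros_pos[OF fin]
    unfolding card_zero_set_Suc[OF fin] of_nat_sum by (intro sum_pos) force+
  have "ln (?Z\<^sup>2) \<le> ln (?N * ?W)"
    using card_zero_set_square_le[OF fin, of n F]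
    by (simp only: ln_le_cancel_iff[OF zero_less_power[OF Z] mult_pos_pos[OF N W]])
  thus ?thesis using N W Z by (simp add: ln_mult ln_realpow)
qed

section \<open>Zeros on a strip\<close>

text \<open>Isolates the last variable, so that freezing the others leaves a power of
  \<open>x\<close> with a constant coefficient.\<close>

lemma (in cring) monom_eval_snoc:
  assumes a: "a \<in> affine_space R n" and x: "x \<in> carrier R" and m: "set_mset m \<subseteq> {..<Suc n}"
  shows "monom_eval R (a @ [x]) m =
           finprod R (\<lambda>i. (a ! i) [^] count m i) {..<n} \<otimes> x [^] count m n"
proof -
  have len: "length a = n" and ai: "\<And>i. i < n \<Longrightarrow> a ! i \<in> carrier R"
    using a by (auto simp: affine_space_def subset_iff)
  have "a @ [x] \<in> affine_space R (Suc n)" using a x by (simp add: append_in_affine_space_iff)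
  from monom_eval_eq[OF this m]
  have "monom_eval R (a @ [x]) m = finprod R (\<lambda>i. ((a @ [x]) ! i) [^] count m i) (insert n {..<n})"
    by (simp add: lessThan_Suc)
  also have "\<dots> = x [^] count m n \<otimes> finprod R (\<lambda>i. ((a @ [x]) ! i) [^] count m i) {..<n}"
    using ai x len by (subst finprod_insert) (auto simp: nth_append)
  also have "finprod R (\<lambda>i. ((a @ [x]) ! i) [^] count m i) {..<n} =
               finprod R (\<lambda>i. (a ! i) [^] count m i) {..<n}"
    using ai x len by (intro finprod_cong') (auto simp: nth_append)
  finally show ?thesis using ai x by (simp add: m_comm)
qed

text \<open>Several monomials may share an exponent \<open>k m\<close>, so the univariate polynomial
  is built by adding one \<open>monom\<close> at a time. Since a \<open>monom\<close> with
  coefficient zero has leading zeros, membership in \<open>poly_ring R\<close> is left to a later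
  normalization.\<close>

lemma (in cring) finsum_monoms_eval:
  assumes "finite M" "\<And>m. m \<in> M \<Longrightarrow> b m \<in> carrier R" "\<And>m. m \<in> M \<Longrightarrow> k m \<le> d"
  shows "\<exists>p. set p \<subseteq> carrier R \<and> length p \<le> Suc d \<and>
           (\<forall>x\<in>carrier R. eval p x = (\<Oplus>m\<in>M. b m \<otimes> x [^] (k m :: nat)))"
  using assms
proof (induction M)
  case empty
  thus ?case by (intro exI[of _ "[]"]) simp
next
  case (insert m M)
  then obtain p where p: "set p \<subseteq> carrier R" "length p \<le> Suc d"
    "\<And>x. x \<in> carrier R \<Longrightarrow> eval p x = (\<Oplus>m\<in>M. b m \<otimes> x [^] k m)" by auto
  have b: "b m \<in> carrier R" using insert.prems by simp
  have mon: "set (monom (b m) (k m)) \<subseteq> carrier R" "length (monom (b m) (k m)) \<le> Suc d"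
    using b insert.prems by (auto simp: monom_def)
  show ?case
  proof (intro exI conjI ballI)
    show "set (poly_add (monom (b m) (k m)) p) \<subseteq> carrier R"
      using poly_add_in_carrier[OF mon(1) p(1)] .
    show "length (poly_add (monom (b m) (k m)) p) \<le> Suc d"
      using poly_add_length_le[of "monom (b m) (k m)" p] mon(2) p(2) by linarith
    fix x assume x: "x \<in> carrier R"
    show "eval (poly_add (monom (b m) (k m)) p) x = (\<Oplus>m\<in>insert m M. b m \<otimes> x [^] k m)"
      using eval_poly_add[OF mon(1) p(1) x] eval_monom[OF b x] p(3)[OF x] insert x
      by (subst finsum_insert) (auto simp: Pi_def)
  qed
qed

lemma (in field) mpoly_eval_strip:
  assumes F: "F \<in> mpolys_deg_le R (Suc n) d" and a: "a \<in> affine_space R n"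
  obtains p where "p \<in> carrier (poly_ring R)" "degree p \<le> d"
    "\<And>x. x \<in> carrier R \<Longrightarrow> eval p x = mpoly_eval R F (a @ [x])"
proof -
  let ?M = "monoms_deg_le (Suc n) d"
  let ?c = "\<lambda>m. finprod R (\<lambda>i. (a ! i) [^] count m i) {..<n}"
  have ai: "a ! i \<in> carrier R" if "i < n" for i
    using a that by (auto simp: affine_space_def subset_iff)
  have c: "?c m \<in> carrier R" for m using ai by (intro finprod_closed) auto
  have k: "count m n \<le> d" if "m \<in> ?M" for m
    using that count_le_size[of m n] by (auto simp: monoms_deg_le_def)
  obtain p where p: "set p \<subseteq> carrier R" "length p \<le> Suc d"
    "\<And>x. x \<in> carrier R \<Longrightarrow> eval p x = (\<Oplus>m\<in>?M. (F m \<otimes> ?c m) \<otimes> x [^] count m n)"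
    using finsum_monoms_eval[OF finite_monoms_deg_le, of "Suc n" d "\<lambda>m. F m \<otimes> ?c m" "\<lambda>m. count m n" d]
      mpolys_deg_leD[OF F] c k by auto
  show thesis
  proof (rule that)
    show "normalize p \<in> carrier (poly_ring R)"
      using normalize_gives_polynomial[OF p(1)] by (simp add: univ_poly_carrier)
    show "degree (normalize p) \<le> d"
      using normalize_length_le[of p] p(2) by linarith
    fix x assume x: "x \<in> carrier R"
    have ax: "a @ [x] \<in> affine_space R (Suc n)"
      using a x by (simp add: append_in_affine_space_iff)
    have "eval (normalize p) x = (\<Oplus>m\<in>?M. (F m \<otimes> ?c m) \<otimes> x [^] count m n)"
      using eval_normalize[OF p(1) x] p(3)[OF x] by simp
    also have "\<dots> = (\<Oplus>m\<in>?M. F m \<otimes> monom_eval R (a @ [x]) m)"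
      using mpolys_deg_leD[OF F] c x
      by (intro finsum_cong') (auto simp: monom_eval_snoc[OF a x] monoms_deg_le_def m_assoc)
    finally show "eval (normalize p) x = mpoly_eval R F (a @ [x])"
      by (simp add: mpoly_eval_eq[OF F ax])
  qed
qed

lemma (in field) card_strip_zeros_le:
  assumes F: "F \<in> mpolys_deg_le R (Suc n) d" and a: "a \<in> affine_space R n"
    and ne: "strip_zeros R F a \<noteq> carrier R"
  shows "card (strip_zeros R F a) \<le> d"
proof -
  obtain p where p: "p \<in> carrier (poly_ring R)" "degree p \<le> d"
    "\<And>x. x \<in> carrier R \<Longrightarrow> eval p x = mpoly_eval R F (a @ [x])"
    using mpoly_eval_strip[OF F a] by metis
  \<comment> \<open>The empty list is the zero polynomial, which would vanish on the whole
    strip.\<close>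
  have "p \<noteq> []" using p(3) ne by (auto simp: strip_zeros_def)
  hence "strip_zeros R F a \<subseteq> set_mset (roots p)"
    using p(3) by (auto simp: strip_zeros_def roots_mem_iff_is_root[OF p(1)] is_root_def)
  hence "card (strip_zeros R F a) \<le> card (set_mset (roots p))" by (intro card_mono) auto
  also have "\<dots> = size (mset_set (set_mset (roots p)))" by simp
  also have "\<dots> \<le> size (roots p)"
    by (rule size_mset_mono[OF mset_set_set_mset_msubset])
  also have "\<dots> \<le> d" using size_roots_le_degree[OF p(1)] p(2) by linarith
  finally show ?thesis .
qed

section \<open>Moments of the number of zeros\<close>

text \<open>Linearity of expectation: after exchanging the sums, each event has probability q to the
  power \<open>- card (T i)\<close>. As \<open>T i\<close> is a set, coinciding points lower the
  exponent by themselves. The moments below are instances of this.\<close>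

lemma (in field) sum_card_vanishing:
  assumes fin: "finite (carrier R)" and I: "finite I"
    and T: "\<And>i. i \<in> I \<Longrightarrow> finite (T i) \<and> T i \<subseteq> affine_space R r \<and> card (T i) \<le> Suc d"
  shows "(\<Sum>F\<in>mpolys_deg_le R r d. real (card {i\<in>I. \<forall>t\<in>T i. mpoly_eval R F t = \<zero>})) =
           real (card (mpolys_deg_le R r d)) * (\<Sum>i\<in>I. 1 / real (card (carrier R)) ^ card (T i))"
proof -
  let ?S = "mpolys_deg_le R r d" and ?q = "real (card (carrier R))"
  have finS: "finite ?S" by (rule finite_mpolys_deg_le[OF fin])
  have q: "?q > 0" using fin by (auto simp: card_gt_0_iff)
  have "(\<Sum>F\<in>?S. real (card {i\<in>I. \<forall>t\<in>T i. mpoly_eval R F t = \<zero>}))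
      = (\<Sum>F\<in>?S. \<Sum>i\<in>I. of_bool (\<forall>t\<in>T i. mpoly_eval R F t = \<zero>))"
    using I by (simp add: Int_def)
  also have "\<dots> = (\<Sum>i\<in>I. \<Sum>F\<in>?S. of_bool (\<forall>t\<in>T i. mpoly_eval R F t = \<zero>))"
    by (rule sum.swap)
  also have "\<dots> = (\<Sum>i\<in>I. real (card ?S) / ?q ^ card (T i))"
  proof (rule sum.cong[OF refl])
    fix i assume i: "i \<in> I"
    have "real (card {F\<in>?S. \<forall>t\<in>T i. mpoly_eval R F t = \<zero>}) * ?q ^ card (T i) = real (card ?S)"
      using arg_cong[OF card_mpolys_vanishing[OF fin, of "T i" r d], of real] T[OF i] by simp
    thus "(\<Sum>F\<in>?S. of_bool (\<forall>t\<in>T i. mpoly_eval R F t = \<zero>)) = real (card ?S) / ?q ^ card (T i)"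
      using finS q by (simp add: Int_def field_simps)
  qed
  finally show ?thesis by (simp add: sum_distrib_left)
qed

lemma (in field) sum_card_zero_set:
  assumes fin: "finite (carrier R)"
  shows "(\<Sum>F\<in>mpolys_deg_le R (Suc n) d. real (card (zero_set R (Suc n) F))) =
           real (card (mpolys_deg_le R (Suc n) d)) * real (card (carrier R)) ^ n"
proof -
  have q: "card (carrier R) > 0" using fin by (auto simp: card_gt_0_iff)
  have "(\<Sum>F\<in>mpolys_deg_le R (Suc n) d. real (card (zero_set R (Suc n) F))) =
     real (card (mpolys_deg_le R (Suc n) d)) *
      (\<Sum>p\<in>affine_space R (Suc n). 1 / real (card (carrier R)) ^ card {p})"
    unfolding zero_set_def
    using sum_card_vanishing[OF fin finite_affine_space[OF fin], of "Suc n" "\<lambda>p. {p}" "Suc n" d]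
    by simp
  thus ?thesis using q by (simp add: card_affine_space[OF fin])
qed

text \<open>The square counts ordered pairs of zeros; a pair of points has probability q^-2 off the
  diagonal and q^-1 on it. Two points require \<open>d \<ge> 1\<close>.\<close>

lemma (in field) sum_card_zero_set_square:
  assumes fin: "finite (carrier R)" and d: "d \<ge> 1"
  shows "(\<Sum>F\<in>mpolys_deg_le R (Suc n) d. (real (card (zero_set R (Suc n) F)))\<^sup>2) \<le>
           real (card (mpolys_deg_le R (Suc n) d)) *
             ((real (card (carrier R)) ^ n)\<^sup>2 + real (card (carrier R)) ^ n)"
proof -
  let ?S = "mpolys_deg_le R (Suc n) d" and ?q = "real (card (carrier R))"
  let ?A = "affine_space R (Suc n)"
  have q: "?q > 0" using fin by (auto simp: card_gt_0_iff)
  have finA: "finite ?A" by (rule finite_affine_space[OF fin])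
  have sq: "(real (card (zero_set R (Suc n) F)))\<^sup>2 =
      real (card {i\<in>?A \<times> ?A. \<forall>t\<in>{fst i, snd i}. mpoly_eval R F t = \<zero>})" for F
  proof -
    have "{i\<in>?A \<times> ?A. \<forall>t\<in>{fst i, snd i}. mpoly_eval R F t = \<zero>}
            = zero_set R (Suc n) F \<times> zero_set R (Suc n) F"
      by (auto simp: zero_set_def)
    thus ?thesis by (simp add: card_cartesian_product power2_eq_square)
  qed
  have T: "finite {fst i, snd i} \<and> {fst i, snd i} \<subseteq> ?A \<and> card {fst i, snd i} \<le> Suc d"
    if "i \<in> ?A \<times> ?A" for i
    using that d by (auto simp: card_insert_if)
  have "finite (?A \<times> ?A)" using finA by simp
  hence "(\<Sum>F\<in>?S. (real (card (zero_set R (Suc n) F)))\<^sup>2) =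
      real (card ?S) * (\<Sum>i\<in>?A \<times> ?A. 1 / ?q ^ card {fst i, snd i})"
    unfolding sq by (rule sum_card_vanishing[OF fin _ T])
  also have "(\<Sum>i\<in>?A \<times> ?A. 1 / ?q ^ card {fst i, snd i}) =
     (\<Sum>p\<in>?A. \<Sum>p'\<in>?A. 1 / ?q ^ card {p, p'})"
    by (simp add: sum.cartesian_product case_prod_unfold)
  \<comment> \<open>The diagonal terms are overestimated by \<open>1 / ?q\<^sup>2\<close>, which
    lets the inner sum be evaluated uniformly.\<close>
  also have "\<dots> \<le> (\<Sum>p\<in>?A. \<Sum>p'\<in>?A. (if p = p' then 1 / ?q else 0) + 1 / ?q\<^sup>2)"
    using q by (intro sum_mono) (auto simp: power2_eq_square)
  also have "\<dots> = (\<Sum>p\<in>?A. 1 / ?q + ?q ^ Suc n / ?q\<^sup>2)"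
    using finA by (intro sum.cong refl) (simp add: sum.distrib card_affine_space[OF fin])
  also have "\<dots> = ?q ^ Suc n * (1 / ?q + ?q ^ Suc n / ?q\<^sup>2)"
    by (simp add: card_affine_space[OF fin])
  also have "\<dots> = (?q ^ n)\<^sup>2 + ?q ^ n"
  proof -
    have "x * y * (1 / x + x * y / x\<^sup>2) = y\<^sup>2 + y" if "x > 0" for x y :: real
      using that by (simp add: field_simps power2_eq_square)
    from this[OF q] show ?thesis by simp
  qed
  finally show ?thesis by (simp add: mult_left_mono)
qed

text \<open>Ordered pairs of zeros on a common strip are counted; empty strips contribute nothing.
  Equality matters, as the sum later enters an upper bound with a negative coefficient.\<close>

lemma (in field) sum_strip_zeros_square:
  assumes fin: "finite (carrier R)" and d: "d \<ge> 1"
  shows "(\<Sum>F\<in>mpolys_deg_le R (Suc n) d.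
            \<Sum>a\<in>good_strips R n F. (real (card (strip_zeros R F a)))\<^sup>2) =
           real (card (mpolys_deg_le R (Suc n) d)) *
             (real (card (carrier R)) ^ n * (2 - 1 / real (card (carrier R))))"
proof -
  let ?S = "mpolys_deg_le R (Suc n) d" and ?q = "real (card (carrier R))"
  let ?A = "affine_space R n" and ?C = "carrier R"
  let ?I = "?A \<times> ?C \<times> ?C" and ?T = "\<lambda>i. {fst i @ [fst (snd i)], fst i @ [snd (snd i)]}"
  have q: "?q > 0" using fin by (auto simp: card_gt_0_iff)
  have finA: "finite ?A" by (rule finite_affine_space[OF fin])
  have "(\<Sum>a\<in>good_strips R n F. (real (card (strip_zeros R F a)))\<^sup>2) =
      real (card {i\<in>?I. \<forall>t\<in>?T i. mpoly_eval R F t = \<zero>})" for F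
  proof -
    have "{i\<in>?I. \<forall>t\<in>?T i. mpoly_eval R F t = \<zero>} =
        (SIGMA a:good_strips R n F. strip_zeros R F a \<times> strip_zeros R F a)"
      by (auto simp: strip_zeros_def good_strips_def)
    thus ?thesis using finite_good_strips[OF fin] finite_strip_zeros[OF fin]
      by (simp add: card_SigmaI card_cartesian_product power2_eq_square)
  qed
  hence "(\<Sum>F\<in>?S. \<Sum>a\<in>good_strips R n F. (real (card (strip_zeros R F a)))\<^sup>2) =
      real (card ?S) * (\<Sum>i\<in>?I. 1 / ?q ^ card (?T i))"
    using sum_card_vanishing[OF fin, of ?I ?T "Suc n" d] finA fin d
    by (simp add: card_insert_if append_in_affine_space_iff mem_Times_iff)
  also have "(\<Sum>i\<in>?I. 1 / ?q ^ card (?T i)) =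
     (\<Sum>a\<in>?A. \<Sum>x\<in>?C. \<Sum>y\<in>?C. 1 / ?q ^ card {a @ [x], a @ [y]})"
    by (simp add: sum.cartesian_product case_prod_unfold)
  also have "\<dots> = (\<Sum>a\<in>?A. \<Sum>x\<in>?C. \<Sum>y\<in>?C. (if x = y then 1 / ?q - 1 / ?q\<^sup>2 else 0) + 1 / ?q\<^sup>2)"
    by (intro sum.cong refl) (auto simp: power2_eq_square)
  also have "\<dots> = ?q ^ n * (?q * (1 / ?q - 1 / ?q\<^sup>2 + ?q * (1 / ?q\<^sup>2)))"
    using fin by (simp add: sum.distrib card_affine_space[OF fin])
  also have "\<dots> = ?q ^ n * (2 - 1 / ?q)"
  proof -
    have "x * (1 / x - 1 / x\<^sup>2 + x * (1 / x\<^sup>2)) = 2 - 1 / x" if "x > 0" for x :: real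
      using that by (simp add: field_simps power2_eq_square)
    from this[OF q] show ?thesis by simp
  qed
  finally show ?thesis .
qed

text \<open>In degree two a strip contains at most two zeros, unless the polynomial vanishes on it, which
  has probability \<open>q\<^sup>-\<^sup>3\<close>; so \<open>1 / N\<close> can be replaced by the quadratic polynomial
  \<open>(7 N - 3 N\<^sup>2) / 4\<close>, which takes the same values at \<open>1\<close> and \<open>2\<close>.\<close>

lemma (in field) sum_inverse_strip_zeros:
  assumes fin: "finite (carrier R)" and q3: "card (carrier R) \<ge> 3"
  shows "(\<Sum>F\<in>mpolys_deg_le R (Suc n) 2.
            \<Sum>a\<in>good_strips R n F. 1 / real (card (strip_zeros R F a))) \<le>
           real (card (mpolys_deg_le R (Suc n) 2)) *
             (real (card (carrier R)) ^ n / 4 * (1 + 7 / real (card (carrier R))))"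
proof -
  let ?S = "mpolys_deg_le R (Suc n) 2" and ?q = "real (card (carrier R))"
  let ?A = "affine_space R n" and ?n = "\<lambda>F a. real (card (strip_zeros R F a))"
  have q: "?q \<ge> 3" using q3 by simp
  have finA: "finite ?A" by (rule finite_affine_space[OF fin])
  \<comment> \<open>Vanishing at three fixed points of a strip is necessary for vanishing on all of
    it, and three is the number of independent values available in degree two.\<close>
  obtain Y where Y: "Y \<subseteq> carrier R" "card Y = 3" "finite Y"
    using obtain_subset_with_card_n[OF q3] by metis
  define T where "T = (\<lambda>a. (\<lambda>x. a @ [x]) ` Y)"
  have cT: "card (T a) = 3" for a
    unfolding T_def using Y by (subst card_image) (auto simp: inj_on_def)
  let ?v = "\<lambda>F. {a\<in>?A. \<forall>t\<in>T a. mpoly_eval R F t = \<zero>}"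
  have V: "(\<Sum>F\<in>?S. real (card (?v F))) = real (card ?S) * (?q ^ n / ?q ^ 3)"
  proof -
    have "finite (T a) \<and> T a \<subseteq> affine_space R (Suc n) \<and> card (T a) \<le> Suc 2" if "a \<in> ?A" for a
      using that Y cT[of a] by (auto simp: T_def append_in_affine_space_iff)
    from sum_card_vanishing[OF fin finA this] show ?thesis
      by (simp add: cT card_affine_space[OF fin])
  qed
  have "(\<Sum>a\<in>good_strips R n F. 1 / ?n F a) \<le>
      7 / 4 * real (card (zero_set R (Suc n) F)) - 3 / 4 * (\<Sum>a\<in>good_strips R n F. (?n F a)\<^sup>2)
       + ?q\<^sup>2 * real (card (?v F))" if F: "F \<in> ?S" for F
  proof -
    have "1 / ?n F a \<le> 7 / 4 * ?n F a - 3 / 4 * (?n F a)\<^sup>2 +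
        ?q\<^sup>2 * of_bool (\<forall>t\<in>T a. mpoly_eval R F t = \<zero>)" if a: "a \<in> good_strips R n F" for a
    proof (cases "strip_zeros R F a = carrier R")
      case True
      hence "\<forall>t\<in>T a. mpoly_eval R F t = \<zero>"
        using Y by (auto simp: T_def strip_zeros_def)
      \<comment> \<open>At N = q the replacement polynomial is negative; the penalty
        \<open>?q\<^sup>2\<close> outweighs it.\<close>
      moreover have "1 / ?q \<le> 7 / 4 * ?q - 3 / 4 * ?q\<^sup>2 + ?q\<^sup>2"
      proof -
        have "1 / ?q \<le> 1" using q by simp
        moreover have "?q\<^sup>2 \<ge> 0" by simp
        ultimately show ?thesis using q by linarith
      qed
      ultimately show ?thesis using True by simp
    next
      case False
      have "card (strip_zeros R F a) \<le> 2"
        using card_strip_zeros_le[OF F _ False] a by (simp add: good_strips_def)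
      moreover have "card (strip_zeros R F a) > 0" by (rule card_strip_zeros_pos[OF fin a])
      ultimately have "card (strip_zeros R F a) = 1 \<or> card (strip_zeros R F a) = 2" by linarith
      hence "1 / ?n F a = 7 / 4 * ?n F a - 3 / 4 * (?n F a)\<^sup>2" by auto
      thus ?thesis by simp
    qed
    hence "(\<Sum>a\<in>good_strips R n F. 1 / ?n F a) \<le>
        (\<Sum>a\<in>good_strips R n F. 7 / 4 * ?n F a - 3 / 4 * (?n F a)\<^sup>2 +
           ?q\<^sup>2 * of_bool (\<forall>t\<in>T a. mpoly_eval R F t = \<zero>))"
      by (rule sum_mono)
    also have "\<dots> = 7 / 4 * (\<Sum>a\<in>good_strips R n F. ?n F a)
        - 3 / 4 * (\<Sum>a\<in>good_strips R n F. (?n F a)\<^sup>2)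
        + ?q\<^sup>2 * (\<Sum>a\<in>good_strips R n F. of_bool (\<forall>t\<in>T a. mpoly_eval R F t = \<zero>))"
      by (simp only: sum.distrib sum_subtractf sum_distrib_left)
    also have "(\<Sum>a\<in>good_strips R n F. of_bool (\<forall>t\<in>T a. mpoly_eval R F t = \<zero>)) \<le>
        (\<Sum>a\<in>?A. of_bool (\<forall>t\<in>T a. mpoly_eval R F t = \<zero>) :: real)"
      using finA by (intro sum_mono2) (auto simp: good_strips_def)
    also have "\<dots> = real (card (?v F))" using finA by (simp add: Int_def)
    finally show ?thesis by (simp add: card_zero_set_Suc[OF fin] mult_left_mono)
  qed
  hence "(\<Sum>F\<in>?S. \<Sum>a\<in>good_strips R n F. 1 / ?n F a) \<le>
      (\<Sum>F\<in>?S. 7 / 4 * real (card (zero_set R (Suc n) F))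
        - 3 / 4 * (\<Sum>a\<in>good_strips R n F. (?n F a)\<^sup>2) + ?q\<^sup>2 * real (card (?v F)))"
    by (rule sum_mono)
  also have "\<dots> = 7 / 4 * (\<Sum>F\<in>?S. real (card (zero_set R (Suc n) F)))
       - 3 / 4 * (\<Sum>F\<in>?S. \<Sum>a\<in>good_strips R n F. (?n F a)\<^sup>2)
       + ?q\<^sup>2 * (\<Sum>F\<in>?S. real (card (?v F)))"
    by (simp only: sum.distrib sum_subtractf sum_distrib_left)
  also have "\<dots> = real (card ?S) * (?q ^ n / 4 * (1 + 7 / ?q))"
  proof -
    \<comment> \<open>The 7 arises from 7/4 - (3/4)(2 - 1/q) + 1/q = (1 + 7/q)/4, the last summand
      1/q being the penalty q^2 times the probability q^-3.\<close>
    have "7 / 4 * (s * Q) - 3 / 4 * (s * (Q * (2 - 1 / x))) + x\<^sup>2 * (s * (Q / x ^ 3)) =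
        s * (Q / 4 * (1 + 7 / x))" if "x \<noteq> 0" for s Q x :: real
      using that by (simp add: field_simps power2_eq_square power3_eq_cube)
    from this[of ?q "real (card ?S)" "?q ^ n"] show ?thesis
      unfolding sum_card_zero_set[OF fin] V
      using sum_strip_zeros_square[OF fin, of 2 n] q by simp
  qed
  finally show ?thesis .
qed

section \<open>Average logarithms\<close>

text \<open>The quadratic error term carries a factor of order \<open>ln Q\<close> so that the bound also covers
  \<open>z = 0\<close>, where \<open>ln z = 0\<close>.\<close>

lemma ln_nat_ge_quadratic:
  fixes z :: nat and Q :: real
  assumes Q: "Q \<ge> 1"
  shows "ln (real z) \<ge> ln Q + (real z / Q - 1) - (2 + 4 * ln Q) * (real z / Q - 1)\<^sup>2"
proof -
  define t where "t = real z / Q - 1"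
  have lnQ: "ln Q \<ge> 0" using Q by simp
  show ?thesis
  proof (cases "t \<ge> - 1 / 2")
    case True
    have z: "real z = Q * (1 + t)" using Q by (simp add: t_def)
    have t1: "1 + t \<ge> 1 / 2" using True by simp
    \<comment> \<open>Away from t = -1 this yields
      \<open>ln (1 + t) \<ge> t - t\<^sup>2 / (1 + t)\<close>, which is at least
      \<open>t - 2 * t\<^sup>2\<close>.\<close>
    have "ln (1 / (1 + t)) \<le> 1 / (1 + t) - 1" using t1 by (intro ln_le_minus_one) auto
    hence "ln (1 + t) \<ge> 1 - 1 / (1 + t)" using t1 by (simp add: ln_div)
    moreover have "1 - 1 / (1 + t) = t - t\<^sup>2 / (1 + t)"
      using t1 by (simp add: field_simps power2_eq_square)
    moreover have "t\<^sup>2 / (1 + t) \<le> t\<^sup>2 / (1 / 2)"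
      using t1 by (intro divide_left_mono) auto
    moreover have "ln Q * t\<^sup>2 \<ge> 0" using lnQ by simp
    moreover have "ln (real z) = ln Q + ln (1 + t)" unfolding z using Q t1 by (simp add: ln_mult)
    ultimately show ?thesis unfolding t_def[symmetric] by (simp add: algebra_simps)
  next
    case False
    hence "(1 / 2)\<^sup>2 \<le> (- t)\<^sup>2" by (intro power_mono) auto
    hence "t\<^sup>2 \<ge> 1 / 4" by (simp add: power2_eq_square)
    \<comment> \<open>The quadratic term is at least \<open>1 / 2 + ln Q\<close>, which makes the
      right-hand side of the claim negative, while \<open>ln\<close> is nonnegative on natural
      numbers, including \<open>ln 0 = 0\<close>.\<close>
    hence "(2 + 4 * ln Q) * t\<^sup>2 \<ge> (2 + 4 * ln Q) * (1 / 4)" using lnQ by (intro mult_left_mono) auto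
    moreover have "ln (real z) \<ge> 0" by (cases "z = 0") auto
    ultimately show ?thesis unfolding t_def[symmetric] using False by (simp add: algebra_simps)
  qed
qed

text \<open>Jensen's inequality by the tangent at \<open>m\<close>. The condition
  \<open>m \<ge> 3\<close> gives \<open>ln m \<ge> 1\<close>, so that the tangent also dominates the
  default value \<open>ln 0 = 0\<close>.\<close>

lemma sum_ln_le:
  fixes f :: "'c \<Rightarrow> real"
  assumes m: "m \<ge> 3" and f: "\<And>x. x \<in> S \<Longrightarrow> f x \<ge> 0"
    and sum: "sum f S \<le> real (card S) * m"
  shows "(\<Sum>x\<in>S. ln (f x)) \<le> real (card S) * ln m"
proof -
  have lnm: "ln m \<ge> 1" using m exp_le by (subst ln_ge_iff) auto
  have "ln (f x) \<le> ln m - 1 + f x / m" if "x \<in> S" for x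
  proof (cases "f x = 0")
    case False
    hence "f x > 0" using f[OF that] by simp
    thus ?thesis using ln_le_tangent[of "f x" m] m by simp
  qed (use lnm in simp)
  hence "(\<Sum>x\<in>S. ln (f x)) \<le> (\<Sum>x\<in>S. ln m - 1 + f x / m)" by (rule sum_mono)
  also have "\<dots> = real (card S) * (ln m - 1) + sum f S / m"
    by (simp add: sum.distrib sum_divide_distrib)
  also have "sum f S / m \<le> real (card S)" using sum m by (simp add: field_simps)
  finally show ?thesis by (simp add: algebra_simps)
qed

text \<open>In the mean of the quadratic minorant the linear term vanishes, and the variance bound
  \<open>Q\<close> makes the mean of \<open>(Z / Q - 1)\<^sup>2\<close> at most
  \<open>1 / Q\<close>.\<close>

lemma (in field) sum_ln_card_zero_set_ge:
  fixes n d :: nat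
  assumes fin: "finite (carrier R)" and d: "d \<ge> 1"
  defines "s \<equiv> real (card (mpolys_deg_le R (Suc n) d))"
    and "Q \<equiv> real (card (carrier R)) ^ n"
  shows "(\<Sum>F\<in>mpolys_deg_le R (Suc n) d. ln (real (card (zero_set R (Suc n) F)))) \<ge>
           s * (ln Q - (2 + 4 * ln Q) / Q)"
proof -
  let ?S = "mpolys_deg_le R (Suc n) d" and ?Z = "\<lambda>F. real (card (zero_set R (Suc n) F))"
  let ?K = "2 + 4 * ln Q"
  have "card (carrier R) > 0" using fin by (auto simp: card_gt_0_iff)
  hence Q: "Q \<ge> 1" unfolding Q_def by (intro one_le_power) auto
  have K: "?K \<ge> 0" using Q by simp
  have lin: "(\<Sum>F\<in>?S. a + b * f F - c * g F) = s * a + b * sum f ?S - c * sum g ?S"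
    for a b c :: real and f g
    by (simp only: sum.distrib sum_subtractf sum_distrib_left sum_constant s_def)
  have "(\<Sum>F\<in>?S. (ln Q - 1 - ?K) + (1 + 2 * ?K) / Q * ?Z F - ?K / Q\<^sup>2 * (?Z F)\<^sup>2)
      \<le> (\<Sum>F\<in>?S. ln (?Z F))"
  proof (rule sum_mono)
    fix F
    have "(ln Q - 1 - ?K) + (1 + 2 * ?K) / Q * ?Z F - ?K / Q\<^sup>2 * (?Z F)\<^sup>2 =
        ln Q + (?Z F / Q - 1) - ?K * (?Z F / Q - 1)\<^sup>2"
      using Q by (simp add: power2_eq_square field_simps)
    thus "(ln Q - 1 - ?K) + (1 + 2 * ?K) / Q * ?Z F - ?K / Q\<^sup>2 * (?Z F)\<^sup>2 \<le> ln (?Z F)"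
      using ln_nat_ge_quadratic[OF Q, of "card (zero_set R (Suc n) F)"] by simp
  qed
  also have "(\<Sum>F\<in>?S. (ln Q - 1 - ?K) + (1 + 2 * ?K) / Q * ?Z F - ?K / Q\<^sup>2 * (?Z F)\<^sup>2) =
      s * (ln Q - 1 - ?K) + (1 + 2 * ?K) / Q * (\<Sum>F\<in>?S. ?Z F) - ?K / Q\<^sup>2 * (\<Sum>F\<in>?S. (?Z F)\<^sup>2)"
    by (rule lin)
  also have "(\<Sum>F\<in>?S. ?Z F) = s * Q" unfolding s_def Q_def by (rule sum_card_zero_set[OF fin])
  finally have *: "s * (ln Q - 1 - ?K) + (1 + 2 * ?K) / Q * (s * Q)
      - ?K / Q\<^sup>2 * (\<Sum>F\<in>?S. (?Z F)\<^sup>2) \<le> (\<Sum>F\<in>?S. ln (?Z F))" .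
  have "?K / Q\<^sup>2 * (\<Sum>F\<in>?S. (?Z F)\<^sup>2) \<le> ?K / Q\<^sup>2 * (s * (Q\<^sup>2 + Q))"
    unfolding s_def Q_def
    by (rule mult_left_mono[OF sum_card_zero_set_square[OF fin d]]) (use K in \<open>simp add: Q_def\<close>)
  moreover have "s * (l - 1 - k) + (1 + 2 * k) / Q * (s * Q) - k / Q\<^sup>2 * (s * (Q\<^sup>2 + Q))
      = s * (l - k / Q)" for k l
    using Q by (simp add: field_simps power2_eq_square)
  note this[of "ln Q" ?K]
  ultimately show ?thesis using * by linarith
qed

lemma (in field) sum_ln_strip_zeros_square_le:
  assumes fin: "finite (carrier R)" and d: "d \<ge> 1" and Q: "real (card (carrier R)) ^ n \<ge> 2"
  shows "(\<Sum>F\<in>mpolys_deg_le R (Suc n) d.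
            ln (\<Sum>a\<in>good_strips R n F. (real (card (strip_zeros R F a)))\<^sup>2)) \<le>
           real (card (mpolys_deg_le R (Suc n) d)) * ln (2 * real (card (carrier R)) ^ n)"
proof (rule sum_ln_le)
  show "(\<Sum>F\<in>mpolys_deg_le R (Suc n) d. \<Sum>a\<in>good_strips R n F. (real (card (strip_zeros R F a)))\<^sup>2)
      \<le> real (card (mpolys_deg_le R (Suc n) d)) * (2 * real (card (carrier R)) ^ n)"
    unfolding sum_strip_zeros_square[OF fin d] by (intro mult_left_mono) (auto simp: algebra_simps)
qed (use Q in \<open>auto intro: sum_nonneg\<close>)

text \<open>The bound 12 keeps \<open>Q / 4\<close> above the threshold 3 of
  \<open>sum_ln_le\<close>.\<close>

lemma (in field) sum_ln_inverse_strip_zeros_le: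
  assumes fin: "finite (carrier R)" and q: "card (carrier R) \<ge> 3"
    and Q: "real (card (carrier R)) ^ n \<ge> 12"
  shows "(\<Sum>F\<in>mpolys_deg_le R (Suc n) 2.
            ln (\<Sum>a\<in>good_strips R n F. 1 / real (card (strip_zeros R F a)))) \<le>
           real (card (mpolys_deg_le R (Suc n) 2)) *
             ln (real (card (carrier R)) ^ n / 4 * (1 + 7 / real (card (carrier R))))"
proof (rule sum_ln_le[OF _ _ sum_inverse_strip_zeros[OF fin q]])
  have "3 * 1 \<le> real (card (carrier R)) ^ n / 4 * (1 + 7 / real (card (carrier R)))"
    using Q by (intro mult_mono) auto
  thus "3 \<le> real (card (carrier R)) ^ n / 4 * (1 + 7 / real (card (carrier R)))" by simp
qed (auto intro: sum_nonneg)

section \<open>Lower bounds for the average entropy\<close>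

lemma (in field) svs_average_entropy_ge:
  assumes fin: "finite (carrier R)" and d: "d \<ge> 1" and Q2: "real (card (carrier R)) ^ n \<ge> 2"
  defines "Q \<equiv> real (card (carrier R)) ^ n"
  shows "svs_average_entropy R (Suc n) d \<ge> ln Q - ln 2 - (4 + 8 * ln Q) / Q"
proof -
  let ?S = "mpolys_deg_le R (Suc n) d"
  let ?s = "real (card ?S)" and ?Z = "\<lambda>F. real (card (zero_set R (Suc n) F))"
  let ?W = "\<lambda>F. \<Sum>a\<in>good_strips R n F. (real (card (strip_zeros R F a)))\<^sup>2"
  define A where "A = (2 + 4 * ln Q) / Q"
  define H where "H = svs_average_entropy R (Suc n) d"
  have Q0: "Q > 0" using Q2 unfolding Q_def by linarith
  have s: "?s > 0"
    using mpolys_deg_le_const[of \<zero> "Suc n" d] finite_mpolys_deg_le[OF fin] by (auto simp: card_gt_0_iff)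
  \<comment> \<open>The chain \<open>2 * ln Z - ln W \<le> ln NS \<le> H_F\<close> is averaged; the
    \<open>ln 2\<close> lost comes from the mean bound \<open>2 * Q\<close> of
    \<open>W\<close>.\<close>
  have "2 * (?s * (ln Q - (2 + 4 * ln Q) / Q)) - ?s * ln (2 * Q)
      \<le> 2 * (\<Sum>F\<in>?S. ln (?Z F)) - (\<Sum>F\<in>?S. ln (?W F))"
    using sum_ln_card_zero_set_ge[OF fin d, of n] sum_ln_strip_zeros_square_le[OF fin d Q2]
    unfolding Q_def by linarith
  also have "\<dots> = (\<Sum>F\<in>?S. 2 * ln (?Z F) - ln (?W F))"
    by (simp add: sum_subtractf sum_distrib_left)
  also have "\<dots> \<le> (\<Sum>F\<in>?S. svs_entropy R (Suc n) F)"
    using ln_card_good_strips_ge[OF fin] svs_entropy_ge_ln_card[OF fin]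
    by (intro sum_mono) (rule order_trans)
  finally have "?s * (2 * (ln Q - (2 + 4 * ln Q) / Q) - ln (2 * Q))
      \<le> (\<Sum>F\<in>?S. svs_entropy R (Suc n) F)" by (simp add: algebra_simps)
  hence "2 * (ln Q - A) - ln (2 * Q) \<le> svs_average_entropy R (Suc n) d"
    unfolding svs_average_entropy_def A_def using s by (simp add: field_simps)
  moreover have ln2Q: "ln (2 * Q) = ln 2 + ln Q" using Q0 by (simp add: ln_mult)
  ultimately have "ln Q - ln 2 - 2 * A \<le> H"
    unfolding ln2Q H_def[symmetric] by argo
  thus ?thesis by (simp add: A_def H_def)
qed

text \<open>Twice the bound for \<open>ln NS\<close> loses \<open>2 * ln 2\<close>, and the 4 in
  \<open>Q / 4\<close>, the mean of \<open>V\<close> up to \<open>1 + 7 / q\<close>, restores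
  exactly this amount.\<close>

lemma (in field) svs_average_entropy_2_ge:
  assumes fin: "finite (carrier R)" and q: "card (carrier R) \<ge> 3"
    and Q12: "real (card (carrier R)) ^ n \<ge> 12"
  defines "Q \<equiv> real (card (carrier R)) ^ n"
  shows "svs_average_entropy R (Suc n) 2 \<ge>
           ln Q - (8 + 16 * ln Q) / Q - 7 / real (card (carrier R))"
proof -
  let ?S = "mpolys_deg_le R (Suc n) 2" and ?q = "real (card (carrier R))"
  let ?s = "real (card ?S)" and ?Z = "\<lambda>F. real (card (zero_set R (Suc n) F))"
  let ?W = "\<lambda>F. \<Sum>a\<in>good_strips R n F. (real (card (strip_zeros R F a)))\<^sup>2"
  let ?V = "\<lambda>F. \<Sum>a\<in>good_strips R n F. 1 / real (card (strip_zeros R F a))"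
  have d: "(1::nat) \<le> 2" by simp
  have Q2: "real (card (carrier R)) ^ n \<ge> 2" using Q12 by simp
  define A where "A = (2 + 4 * ln Q) / Q"
  define H where "H = svs_average_entropy R (Suc n) 2"
  have Q0: "Q > 0" using Q2 unfolding Q_def by linarith
  have s: "?s > 0"
    using mpolys_deg_le_const[of \<zero> "Suc n" 2] finite_mpolys_deg_le[OF fin] by (auto simp: card_gt_0_iff)
  have "4 * (?s * (ln Q - (2 + 4 * ln Q) / Q)) - 2 * (?s * ln (2 * Q)) - ?s * ln (Q / 4 * (1 + 7 / ?q))
      \<le> 4 * (\<Sum>F\<in>?S. ln (?Z F)) - 2 * (\<Sum>F\<in>?S. ln (?W F)) - (\<Sum>F\<in>?S. ln (?V F))"
    using sum_ln_card_zero_set_ge[OF fin d, of n] sum_ln_strip_zeros_square_le[OF fin d Q2]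
      sum_ln_inverse_strip_zeros_le[OF fin q Q12]
    unfolding Q_def by linarith
  also have "\<dots> = (\<Sum>F\<in>?S. 4 * ln (?Z F) - 2 * ln (?W F) - ln (?V F))"
    by (simp add: sum_subtractf sum_distrib_left)
  also have "\<dots> \<le> (\<Sum>F\<in>?S. svs_entropy R (Suc n) F)"
  proof (rule sum_mono)
    fix F
    show "4 * ln (?Z F) - 2 * ln (?W F) - ln (?V F) \<le> svs_entropy R (Suc n) F"
      using ln_card_good_strips_ge[OF fin, of n F] svs_entropy_ge_collision[OF fin, of n F]
      by linarith
  qed
  finally have "?s * (4 * (ln Q - (2 + 4 * ln Q) / Q) - 2 * ln (2 * Q) - ln (Q / 4 * (1 + 7 / ?q)))
      \<le> (\<Sum>F\<in>?S. svs_entropy R (Suc n) F)" by (simp add: algebra_simps)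
  hence "4 * (ln Q - A) - 2 * ln (2 * Q) - ln (Q / 4 * (1 + 7 / ?q))
      \<le> svs_average_entropy R (Suc n) 2"
    unfolding svs_average_entropy_def A_def using s by (simp add: field_simps)
  moreover have ln2Q: "ln (2 * Q) = ln 2 + ln Q" using Q0 by (simp add: ln_mult)
  moreover have lnV: "ln (Q / 4 * (1 + 7 / ?q)) = ln Q - 2 * ln 2 + ln (1 + 7 / ?q)"
  proof -
    have "1 + 7 / ?q > 0" by (intro add_pos_nonneg) auto
    moreover have "ln (4::real) = 2 * ln 2" using ln_realpow[of 2 2] by simp
    ultimately show ?thesis using Q0 by (simp add: ln_mult ln_div)
  qed
  moreover have "ln (1 + 7 / ?q) \<le> 7 / ?q" by (rule ln_add_one_self_le_self) simp
  ultimately have "ln Q - 4 * A - 7 / ?q \<le> H"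
    unfolding ln2Q lnV H_def[symmetric] by argo
  thus ?thesis by (simp add: A_def H_def)
qed

section \<open>The constants \<open>svs_mu d\<close>\<close>

lemma svs_mu_Suc: "svs_mu (Suc d) = svs_mu d + (- 1) ^ d / fact (Suc d)"
  by (simp add: svs_mu_def)

lemma svs_mu_2: "svs_mu 2 = 1 / 2"
  by (simp add: svs_mu_def numeral_2_eq_2)

text \<open>The partial sums alternate: those of even index increase from the value 5/8 at 4, and
  those of odd index exceed their predecessor. Index 3 is separate because its predecessor is only
  1/2.\<close>

lemma svs_mu_ge:
  assumes "d \<ge> 3"
  shows "svs_mu d \<ge> 5 / 8"
proof -
  have inc: "svs_mu (2 * k + 1) \<ge> svs_mu (2 * k)" for k
    by (simp add: svs_mu_Suc)
  have step: "svs_mu (Suc (Suc m)) \<ge> svs_mu m" if "even m" for m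
  proof -
    have "svs_mu (Suc (Suc m)) = svs_mu m + 1 / fact (Suc m) - 1 / fact (Suc (Suc m))"
      using that by (simp add: svs_mu_Suc del: fact_Suc)
    moreover have "fact (Suc m) \<le> (fact (Suc (Suc m)) :: real)" by (rule fact_mono) simp
    hence "1 / fact (Suc (Suc m)) \<le> (1 / fact (Suc m) :: real)"
      by (intro divide_left_mono) (auto simp del: fact_Suc)
    ultimately show ?thesis by linarith
  qed
  have even: "svs_mu (2 * k + 4) \<ge> 5 / 8" for k
  proof (induction k)
    case 0
    show ?case by (simp add: svs_mu_def numeral_eq_Suc)
  next
    case (Suc k)
    thus ?case using step[of "2 * k + 4"] by simp
  qed
  show ?thesis
  proof (cases "d = 3")
    case True
    show ?thesis unfolding True by (simp add: svs_mu_def numeral_eq_Suc)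
  next
    case False
    hence d: "d \<ge> 4" using assms by simp
    show ?thesis
    proof (cases "even d")
      case True
      then obtain j where "d = 2 * j" by blast
      hence "d = 2 * (j - 2) + 4" using d by simp
      thus ?thesis using even by metis
    next
      case False
      then obtain j where j: "d = 2 * j + 1" by (rule oddE)
      hence "2 * j = 2 * (j - 2) + 4" using d by simp
      hence "svs_mu (2 * j) \<ge> 5 / 8" using even by metis
      thus ?thesis using inc[of j] j by simp
    qed
  qed
qed

section \<open>The uniform error term\<close>

theorem theorem5p6:
  fixes r d :: nat
  assumes "r \<ge> 2" and "d \<ge> 2"
  shows "\<exists>e \<in> O(\<lambda>q::nat. 1 / real q).
           \<forall>R :: 'a ring. field R \<and> finite (carrier R) \<longrightarrow>
             svs_average_entropy R r d
               \<ge> 1 / (2 * svs_mu d) * ln (real (card (carrier R)) ^ (r - 1))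
                   * (1 + e (card (carrier R)))"
proof (intro bexI allI impI)
  \<comment> \<open>The constant 32 exceeds the total error coefficient 24 + 7 for
    \<open>d = 2\<close>, makes the claim trivial below 32, and is \<open>2 ^ 5\<close>, so that a
    fifth of \<open>ln Q\<close> covers \<open>ln 2\<close> above.\<close>
  show "(\<lambda>q. - 32 / real q) \<in> O(\<lambda>q. 1 / real q)"
    by (intro bigoI[of _ 32]) simp
next
  fix R :: "'a ring"
  assume R: "field R \<and> finite (carrier R)"
  interpret field R using R by simp
  have fin: "finite (carrier R)" using R by simp
  define n where "n = r - 1"
  have r: "r = Suc n" and n: "n \<ge> 1" using assms(1) by (auto simp: n_def)
  define q where "q = real (card (carrier R))"
  define Q where "Q = q ^ n"
  define m where "m = 1 / (2 * svs_mu d)"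
  have "card (carrier R) > 0" using fin by (auto simp: card_gt_0_iff)
  hence q1: "q \<ge> 1" by (simp add: q_def)
  have qQ: "q \<le> Q" unfolding Q_def using power_increasing[OF n q1] by simp
  have mu: "svs_mu d \<ge> 1 / 2"
    using svs_mu_2 svs_mu_ge[of d] assms(2) by (cases "d = 2") auto
  hence m0: "m \<ge> 0" by (simp add: m_def)
  define H where "H = svs_average_entropy R (Suc n) d"
  have "m * ln Q * (1 - 32 / q) \<le> H"
  proof (cases "q < 32")
    case True
    \<comment> \<open>For small fields the claimed bound is not positive and the entropy is
      nonnegative.\<close>
    have "1 - 32 / q \<le> 0" using True q1 by (simp add: field_simps)
    moreover have "m * ln Q \<ge> 0" using m0 q1 qQ by simp
    ultimately have "m * ln Q * (1 - 32 / q) \<le> 0" by (rule mult_nonneg_nonpos[rotated])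
    also have "0 \<le> H"
      unfolding H_def svs_average_entropy_def by (intro mult_nonneg_nonneg sum_nonneg svs_entropy_nonneg) auto
    finally show ?thesis .
  next
    case False
    hence q: "q \<ge> 32" by simp
    hence Q: "Q \<ge> 32" using qQ by simp
    have ln2: "5 * ln 2 \<le> ln Q"
    proof -
      have "5 * ln 2 = ln (2 ^ 5 :: real)" by (subst ln_realpow) auto
      also have "\<dots> \<le> ln Q" using q qQ by (subst ln_le_cancel_iff) auto
      finally show ?thesis .
    qed
    have lnQ: "ln Q \<ge> 1" using q qQ exp_le by (subst ln_ge_iff) auto
    \<comment> \<open>Brings all error terms to multiples of \<open>ln Q / q\<close>, using
      \<open>ln Q \<ge> 1\<close> and \<open>q \<le> Q\<close>.\<close>
    have frac: "(a + b * ln Q) / Q \<le> (a + b) * (ln Q / q)" if "a \<ge> 0" "b \<ge> 0" for a b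
    proof -
      have "(a + b * ln Q) / Q \<le> ((a + b) * ln Q) / q"
      proof (rule frac_le)
        show "a + b * ln Q \<le> (a + b) * ln Q"
          using that lnQ mult_left_mono[of 1 "ln Q" a] by (simp add: algebra_simps)
      qed (use that lnQ q qQ in auto)
      thus ?thesis by simp
    qed
    have lq: "ln Q / q \<ge> 0" using lnQ q by simp
    show ?thesis
    proof (cases "d = 2")
      case True
      have m: "m = 1" by (simp add: m_def True svs_mu_2)
      have "ln Q - (8 + 16 * ln Q) / Q - 7 / q \<le> H"
        using q Q unfolding H_def True Q_def q_def by (intro svs_average_entropy_2_ge[OF fin]) linarith+
      moreover have "(8 + 16 * ln Q) / Q \<le> 24 * (ln Q / q)" using frac[of 8 16] by simp
      moreover have "7 / q \<le> 7 * (ln Q / q)" using lnQ q by (simp add: field_simps)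
      moreover have "m * ln Q * (1 - 32 / q) = ln Q - 32 * (ln Q / q)"
        using q by (simp add: m algebra_simps)
      ultimately show ?thesis using lq by linarith
    next
      case False
      hence mu: "svs_mu d \<ge> 5 / 8" using assms(2) by (intro svs_mu_ge) simp
      hence m: "m \<le> 4 / 5" by (simp add: m_def field_simps)
      have "ln Q - ln 2 - (4 + 8 * ln Q) / Q \<le> H"
        using Q assms(2) unfolding H_def Q_def q_def by (intro svs_average_entropy_ge[OF fin]) linarith+
      moreover have "(4 + 8 * ln Q) / Q \<le> 12 * (ln Q / q)" using frac[of 4 8] by simp
      moreover have "m * ln Q * (1 - 32 / q) \<le> 4 / 5 * ln Q * (1 - 32 / q)"
        using m lnQ q by (intro mult_right_mono) auto
      moreover have "4 / 5 * ln Q * (1 - 32 / q) = 4 / 5 * ln Q - 128 / 5 * (ln Q / q)"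
        by (simp add: right_diff_distrib)
      \<comment> \<open>The spare fifth of \<open>ln Q\<close> absorbs \<open>ln 2\<close>, and
        128/5 exceeds the error coefficient 12.\<close>
      ultimately show ?thesis using lq ln2 by linarith
    qed
  qed
  thus "1 / (2 * svs_mu d) * ln (real (card (carrier R)) ^ (r - 1)) *
      (1 + - 32 / real (card (carrier R))) \<le> svs_average_entropy R r d"
    by (simp add: m_def H_def Q_def q_def r)
qed

end
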